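(* Let $N\ge 2$ and consider an $N$-player game with cost functions $f_i:\mathbb{R}^N\to\mathbb{R}$, $i\in\mathcal{N}=\{1,\dots,N\}$, where the action $x_i\in\mathbb{R}$ of player $i$ is governed by $$\dot x_i=b_iu_i+\phi_i(x_i)\theta_i,\quad i\in\mathcal{N},$$ with $b_i\ne0$ an unknown constant, $\theta_i\in\mathbb{R}$ an unknown constant parameter and $\phi_i$ a known sufficiently smooth function. Suppose: (A1) each $f_i$ is sufficiently smooth and $\frac{\partial f_i}{\partial x_i}$ is globally Lipschitz with constant $l_i$; (A2) there is a constant $m>0$ with $(\mathbf{x}-\mathbf{z})^T(\mathcal{P}(\mathbf{x})-\mathcal{P}(\mathbf{z}))\ge m\|\mathbf{x}-\mathbf{z}\|^2$ for all $\mathbf{x},\mathbf{z}\in\mathbb{R}^N$, where $\mathcal{P}(\mathbf{x})=\left[\frac{\partial f_1(\mathbf{x})}{\partial x_1},\dots,\frac{\partial f_N(\mathbf{x})}{\partial x_N}\right]^T$; (A3) the players have an undirected and connected communication graph with adjacency matrix $[a_{ij}]$; (A4) for each $i$, $\phi_i(x_i)$ and $\frac{\partial\phi_i(x_i)}{\partial x_i}$ are bounded provided that $x_i$ is bounded. Let the control input be $$u_i=N_0(k_i)\big(x_i-y_i+\phi_i(x_i)\hat\theta_i\big),\qquad N_0(k)=k^2\sin(k),$$ $$\dot k_i=(x_i-y_i)\big(x_i-y_i+\phi_i(x_i)\hat\theta_i\big),\qquad \dot{\hat\theta}_i=\phi_i(x_i)(x_i-y_i),$$ where $y_i$ is generated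 by $$\dot y_i=-\nabla_i f_i(\mathbf{z}_i),\qquad \dot z_{ij}=-\delta_{ij}\Big(\sum_{k=1}^N a_{ik}(z_{ij}-z_{kj})+a_{ij}(z_{ij}-y_j)\Big),$$ $$\dot\delta_{ij}=\Big(\sum_{k=1}^N a_{ik}(z_{ij}-z_{kj})+a_{ij}(z_{ij}-y_j)\Big)^2,\quad i,j\in\mathcal{N},$$ with $\mathbf{z}_i=[z_{i1},\dots,z_{iN}]^T$. Then (for every initial condition of the closed-loop system) $$\lim_{t\to\infty}\|\mathbf{x}(t)-\mathbf{x}^*\|=0,$$ where $\mathbf{x}=[x_1,\dots,x_N]^T$ and $\mathbf{x}^*$ is the Nash equilibrium of the game, and all the other variables ($k_i,\hat\theta_i,y_i,z_{ij},\delta_{ij}$ for all $i,j\in\mathcal{N}$) stay bounded.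
   Context: Notation: $\nabla_i f_i(\mathbf{z}_i)=\frac{\partial f_i(\mathbf{x})}{\partial x_i}\big|_{\mathbf{x}=\mathbf{z}_i}$; the variables $k_i,\hat\theta_i,y_i,z_{ij},\delta_{ij}$ are real-valued. An action profile $\mathbf{x}^*=(x_i^*,\mathbf{x}_{-i}^* )$ is a Nash equilibrium if for each $i\in\mathcal{N}$, $f_i(x_i^*,\mathbf{x}_{-i}^* )\le f_i(x_i,\mathbf{x}_{-i}^* )$ for all $x_i\in\mathbb{R}$, where $\mathbf{x}_{-i}=[x_1,\dots,x_{i-1},x_{i+1},\dots,x_N]^T$. The signs of the $b_i$ are unknown and need not coincide. Communication graph: node set $\mathcal{N}$, edge set $\mathcal{E}_d$; an edge $(i,j)\in\mathcal{E}_d$ means node $j$ can receive information from node $i$. The adjacency matrix satisfies $a_{ij}>0$ if $(j,i)\in\mathcal{E}_d$, $a_{ij}=0$ otherwise, and $a_{ii}=0$; for an undirected graph $a_{ij}=a_{ji}$. An undirected graph is connected if there is a path between any two distinct nodes. *)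

theory Defs
  imports "HOL-Analysis.Analysis"
begin

text \<open>Players are the elements of a finite type \<open>'n\<close>. "Sufficiently smooth" is read as the
  weakest regularity for which all derivatives occurring below exist and are continuous, namely
  continuous Frechet differentiability.\<close>

definition continuously_differentiable ::
  "('a::real_normed_vector \<Rightarrow> 'b::real_normed_vector) \<Rightarrow> bool" where
  "continuously_differentiable f \<longleftrightarrow>
     (\<exists>f'. (\<forall>x. (f has_derivative blinfun_apply (f' x)) (at x)) \<and> continuous_on UNIV f')"

definition replace_coord :: "real ^ 'n \<Rightarrow> 'n \<Rightarrow> real \<Rightarrow> real ^ 'n" where
  "replace_coord x i s = (\<chi> j. if j = i then s else x $ j)"

definition partial_deriv :: "'n::finite \<Rightarrow> (real ^ 'n \<Rightarrow> real) \<Rightarrow> real ^ 'n \<Rightarrow> real" where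
  "partial_deriv i g x = deriv (\<lambda>s. g (replace_coord x i s)) (x $ i)"

definition pseudo_gradient :: "('n::finite \<Rightarrow> real ^ 'n \<Rightarrow> real) \<Rightarrow> real ^ 'n \<Rightarrow> real ^ 'n" where
  "pseudo_gradient f x = (\<chi> i. partial_deriv i (f i) x)"

definition nash_equilibrium :: "('n::finite \<Rightarrow> real ^ 'n \<Rightarrow> real) \<Rightarrow> real ^ 'n \<Rightarrow> bool" where
  "nash_equilibrium f x \<longleftrightarrow> (\<forall>i s. f i x \<le> f i (replace_coord x i s))"

text \<open>An edge \<open>(i, j)\<close> means that \<open>j\<close> receives information from \<open>i\<close>; hence the transposition in
  the link between \<open>A i j\<close> and \<open>(j, i) \<in> E\<close>.\<close>

definition adjacency_matrix :: "('n \<times> 'n) set \<Rightarrow> ('n \<Rightarrow> 'n \<Rightarrow> real) \<Rightarrow> bool" where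
  "adjacency_matrix E A \<longleftrightarrow>
     (\<forall>i j. ((j, i) \<in> E \<longrightarrow> A i j > 0) \<and> ((j, i) \<notin> E \<longrightarrow> A i j = 0)) \<and> (\<forall>i. A i i = 0)"

definition undirected_graph :: "('n \<times> 'n) set \<Rightarrow> ('n \<Rightarrow> 'n \<Rightarrow> real) \<Rightarrow> bool" where
  "undirected_graph E A \<longleftrightarrow> sym E \<and> (\<forall>i j. A i j = A j i)"

definition connected_graph :: "('n \<times> 'n) set \<Rightarrow> bool" where
  "connected_graph E \<longleftrightarrow> (\<forall>i j. i \<noteq> j \<longrightarrow> (i, j) \<in> E\<^sup>+)"

definition nussbaum :: "real \<Rightarrow> real" where
  "nussbaum k = k\<^sup>2 * sin k"

definition control_input :: "(real \<Rightarrow> real) \<Rightarrow> real \<Rightarrow> real \<Rightarrow> real \<Rightarrow> real \<Rightarrow> real" where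
  "control_input \<phi> x k \<theta>h y = nussbaum k * (x - y + \<phi> x * \<theta>h)"

definition consensus_error ::
  "('n::finite \<Rightarrow> 'n \<Rightarrow> real) \<Rightarrow> real ^ 'n \<Rightarrow> real ^ 'n ^ 'n \<Rightarrow> 'n \<Rightarrow> 'n \<Rightarrow> real" where
  "consensus_error A y z i j =
     (\<Sum>k\<in>UNIV. A i k * (z $ i $ j - z $ k $ j)) + A i j * (z $ i $ j - y $ j)"

text \<open>Below \<open>\<theta>h\<close> is the trajectory of the estimates of the unknown parameters \<open>\<theta>\<close>, and row \<open>z t $ i\<close>
  is player \<open>i\<close>'s estimate of the vector \<open>y t\<close>. Derivatives are taken within the time domain
  \<open>{0..}\<close>, i.e. one-sided at time 0.\<close>

definition closed_loop_solution ::
  "('n::finite \<Rightarrow> real ^ 'n \<Rightarrow> real) \<Rightarrow> ('n \<Rightarrow> real \<Rightarrow> real) \<Rightarrow> ('n \<Rightarrow> real) \<Rightarrow> ('n \<Rightarrow> real)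
    \<Rightarrow> ('n \<Rightarrow> 'n \<Rightarrow> real)
    \<Rightarrow> (real \<Rightarrow> real ^ 'n) \<Rightarrow> (real \<Rightarrow> real ^ 'n) \<Rightarrow> (real \<Rightarrow> real ^ 'n) \<Rightarrow> (real \<Rightarrow> real ^ 'n)
    \<Rightarrow> (real \<Rightarrow> real ^ 'n ^ 'n) \<Rightarrow> (real \<Rightarrow> real ^ 'n ^ 'n) \<Rightarrow> bool" where
  "closed_loop_solution f \<phi> b \<theta> A x k \<theta>h y z \<delta> \<longleftrightarrow>
     (\<forall>t\<ge>0. \<forall>i.
        ((\<lambda>s. x s $ i) has_real_derivative
           b i * control_input (\<phi> i) (x t $ i) (k t $ i) (\<theta>h t $ i) (y t $ i)
             + \<phi> i (x t $ i) * \<theta> i) (at t within {0..}) \<and>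
        ((\<lambda>s. k s $ i) has_real_derivative
           (x t $ i - y t $ i) * (x t $ i - y t $ i + \<phi> i (x t $ i) * \<theta>h t $ i))
           (at t within {0..}) \<and>
        ((\<lambda>s. \<theta>h s $ i) has_real_derivative \<phi> i (x t $ i) * (x t $ i - y t $ i))
           (at t within {0..}) \<and>
        ((\<lambda>s. y s $ i) has_real_derivative - partial_deriv i (f i) (z t $ i))
           (at t within {0..}) \<and>
        (\<forall>j. ((\<lambda>s. z s $ i $ j) has_real_derivative
                - (\<delta> t $ i $ j) * consensus_error A (y t) (z t) i j) (at t within {0..}) \<and>
             ((\<lambda>s. \<delta> s $ i $ j) has_real_derivative
                (consensus_error A (y t) (z t) i j)\<^sup>2) (at t within {0..})))"

end

theory Submission
  imports Defs
begin

text \<open>The closed loop is a cascade. The variables \<open>y, z, \<delta>\<close> evolve among themselves: \<open>y\<close> descends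
  the marginal costs evaluated at the estimates \<open>z\<close>, and \<open>z\<close> follows \<open>y\<close> through a consensus
  protocol with adaptive gains \<open>\<delta>\<close>. Each player's \<open>x, k, \<theta>h\<close> is then driven by \<open>y\<close>. Both stages are
  controlled by an energy that cannot increase.

  Seeking stage. Fix \<open>j\<close> and let \<open>v\<close> be the vector of the gaps \<open>z i j - y j\<close> over all players \<open>i\<close>.
  The consensus error is \<open>e = H v\<close>, where \<open>H\<close> is the graph Laplacian plus the diagonal matrix of
  the weights \<open>A i j\<close>. Connectedness makes \<open>H\<close> positive definite (\<open>pinned_laplacian_pos\<close>).
  The energy adds \<open>\<bar>y - xs\<bar>\<^sup>2 / 2\<close>, where \<open>xs\<close> is the equilibrium, the forms \<open>v \<bullet> H v / 2\<close> and
  \<open>(\<delta> i j - \<delta>s)\<^sup>2 / 2\<close> for a constant \<open>\<delta>s\<close>. In its derivative the unknown adaptive gains cancel and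
  leave \<open>- \<delta>s \<bar>e\<bar>\<^sup>2\<close>. Strong monotonicity contributes \<open>- m \<bar>y - xs\<bar>\<^sup>2\<close>, and what the estimation error
  adds is bounded by a multiple of \<open>\<bar>y - xs\<bar> \<bar>e\<bar> + \<bar>e\<bar>\<^sup>2\<close>. The constant \<open>\<delta>s\<close> occurs in the
  analysis only, so it may be taken so large that the derivative is at most minus the dissipation
  \<open>m/2 \<bar>y - xs\<bar>\<^sup>2 + \<bar>e\<bar>\<^sup>2\<close> (\<open>dominating_gains_exist\<close>).

  Tracking stage. Let \<open>s = x - y\<close> for one player, let \<open>g\<close> be its marginal cost at its estimate, and let
  \<open>F\<close> be a primitive of \<open>b N + 1\<close> for the Nussbaum function \<open>N\<close>. The derivative of
  \<open>s\<^sup>2 / 2 + (\<theta>h - \<theta>)\<^sup>2 / 2 - F k\<close> is \<open>s g - s\<^sup>2\<close>, because the input enters exactly as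
  \<open>b N k'\<close> and the estimate \<open>\<theta>h\<close> cancels the unknown \<open>\<theta>\<close>. Since \<open>g\<^sup>2\<close> is at most a multiple of the
  dissipation, adding a multiple of the seeking energy gives a total energy with derivative at
  most \<open>- s\<^sup>2 / 2\<close>. Hence \<open>F k\<close> stays above a constant. For either sign of \<open>b\<close> the
  function \<open>F\<close> takes arbitrarily negative values on both sides of the initial gain, so by
  continuity \<open>k\<close> cannot leave a bounded interval (\<open>nussbaum_gain_bounded\<close>), and the total energy
  then bounds everything else.

  These bounds depend on the initial values but not on the length of the time interval
  (\<open>a_priori_bound\<close>). They therefore give boundedness, and also global existence:
  a solution of the vector field truncated outside a large ball never reaches the boundary of the ball
  (\<open>global_solution_of_apriori_bound\<close>). Finally \<open>y - xs\<close> and \<open>x - y\<close> have bounded derivatives,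
  and their squares are dominated by the decay of an energy that is bounded below, so they tend
  to zero (\<open>barbalat\<close>).\<close>

section \<open>Elementary estimates\<close>

text \<open>Trading a square for an absolute value up to the constant 1 keeps square roots out of all bounds.\<close>

lemma abs_le_of_square_le:
  fixes a b :: real
  assumes "a\<^sup>2 \<le> b"
  shows "\<bar>a\<bar> \<le> b + 1"
proof -
  have "\<bar>a\<bar> \<le> a\<^sup>2 + 1"
    using zero_le_power2[of "\<bar>a\<bar> - 1/2"] by (simp add: power2_eq_square algebra_simps)
  with assms show ?thesis by simp
qed

lemma norm_vec_le_sum: "norm x \<le> (\<Sum>i\<in>UNIV. norm (x $ i))"
  for x :: "'b::real_normed_vector ^ 'c::finite"
  by (simp add: norm_vec_def L2_set_le_sum)

lemma norm_vec_le_card: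
  fixes v :: "'b::real_normed_vector ^ 'n::finite"
  assumes "\<And>i. norm (v $ i) \<le> B"
  shows "norm v \<le> real CARD('n) * B"
  using order_trans[OF norm_vec_le_sum[of v] sum_bounded_above[of UNIV _ B]] assms by simp

lemma continuous_on_bounded_image:
  assumes "continuous_on UNIV (g :: real \<Rightarrow> real)"
  obtains C where "\<And>s. \<bar>s\<bar> \<le> B \<Longrightarrow> \<bar>g s\<bar> \<le> C"
proof -
  have "bounded (g ` cball 0 B)"
    by (intro compact_imp_bounded compact_continuous_image continuous_on_subset[OF assms]) auto
  then obtain C where "\<forall>s\<in>cball 0 B. \<bar>g s\<bar> \<le> C" by (auto simp: bounded_iff)
  then have "\<bar>g s\<bar> \<le> C" if "\<bar>s\<bar> \<le> B" for s using that by simp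
  then show ?thesis by (rule that)
qed

section \<open>Global solutions of differential equations\<close>

lemma integral_has_vector_derivative_halfline:
  fixes g :: "real \<Rightarrow> 'a::banach"
  assumes "continuous_on UNIV g" and "t \<ge> 0"
  shows "((\<lambda>\<tau>. integral {0..\<tau>} g) has_vector_derivative g t) (at t within {0..})"
proof -
  have "((\<lambda>\<tau>. integral {0..\<tau>} g) has_vector_derivative g t) (at t within {0..t+1})"
    using assms by (intro integral_has_vector_derivative continuous_on_subset[OF assms(1)]) auto
  moreover have "at t within {0..t+1} = at t within {0..}"
    by (rule at_within_nhd[where S="{t-1<..<t+1}"]) auto
  ultimately show ?thesis by simp
qed

text \<open>Banach's fixed point theorem in Bielecki's weighted norm. The unknown is
  \<open>w t = exp (- \<alpha> t) u t\<close> in the space of bounded continuous functions, extended to negative times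
  by its value at 0. With \<open>\<alpha>\<close> larger than twice the Lipschitz constant the integral operator
  contracts by 1/2 on the whole half-line, so no solutions on short intervals have to be
  glued. Boundedness of the field keeps the operator inside the space.\<close>

lemma global_solution_of_global_lipschitz:
  fixes G :: "'a::euclidean_space \<Rightarrow> 'a"
  assumes lip: "L-lipschitz_on UNIV G" and bdd: "bounded (range G)"
  obtains u where "u 0 = x0"
    and "\<And>t. t \<ge> 0 \<Longrightarrow> (u has_vector_derivative G (u t)) (at t within {0..})"
proof -
  define \<alpha> where "\<alpha> = 2 * (L + 1)"
  have L0: "L \<ge> 0" using lip by (rule lipschitz_on_nonneg)
  then have \<alpha>0: "\<alpha> > 0" by (simp add: \<alpha>_def)
  obtain M where M: "\<And>x. norm (G x) \<le> M"
    using bdd by (auto simp: bounded_iff)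
  have M0: "M \<ge> 0" using M[of 0] norm_ge_zero order_trans by blast
  define I where "I w t = x0 + integral {0..t} (\<lambda>s. G (exp (\<alpha> * s) *\<^sub>R apply_bcontfun w s))"
    for w :: "real \<Rightarrow>\<^sub>C 'a" and t
  define \<Phi>0 where "\<Phi>0 w t = exp (- \<alpha> * max 0 t) *\<^sub>R I w (max 0 t)" for w t
  have contG: "continuous_on UNIV (\<lambda>s. G (exp (\<alpha> * s) *\<^sub>R apply_bcontfun w s))" for w
    by (rule continuous_on_compose2[OF lipschitz_on_continuous_on[OF lip]])
       (auto intro!: continuous_intros)
  have derI: "(I w has_vector_derivative G (exp (\<alpha> * t) *\<^sub>R apply_bcontfun w t)) (at t within {0..})"
    if "t \<ge> 0" for w t
    unfolding I_def
    using has_vector_derivative_add[OF has_vector_derivative_const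
        integral_has_vector_derivative_halfline[OF contG that]] by simp
  have contI: "continuous_on {0..} (I w)" for w
    using derI by (auto simp: continuous_on_eq_continuous_within
        intro: has_vector_derivative_continuous)
  have cont\<Phi>: "continuous_on UNIV (\<Phi>0 w)" for w
    unfolding \<Phi>0_def
    by (intro continuous_intros continuous_on_compose2[OF contI]) (auto simp: max_def)
  have normI: "norm (I w t) \<le> norm x0 + M * t" if "t \<ge> 0" for w t
  proof -
    have "norm (integral {0..t} (\<lambda>s. G (exp (\<alpha> * s) *\<^sub>R apply_bcontfun w s))) \<le> M * (t - 0)"
      by (rule integral_bound) (use that M continuous_on_subset[OF contG] in auto)
    then show ?thesis unfolding I_def by (intro norm_triangle_le) auto
  qed
  have bound\<Phi>: "norm (\<Phi>0 w t) \<le> norm x0 + M / \<alpha>" for w and t :: real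
  proof -
    define \<tau> :: real where "\<tau> = max 0 t"
    have \<tau>: "\<tau> \<ge> 0" by (simp add: \<tau>_def max_def)
    have "norm (\<Phi>0 w t) \<le> exp (- (\<alpha> * \<tau>)) * (norm x0 + M * \<tau>)"
      unfolding \<Phi>0_def \<tau>_def[symmetric] using normI[OF \<tau>] by simp
    also have "\<dots> = exp (- (\<alpha> * \<tau>)) * norm x0 + M * (exp (- (\<alpha> * \<tau>)) * \<tau>)"
      by (simp add: algebra_simps)
    also have "\<dots> \<le> 1 * norm x0 + M * (1 / \<alpha>)"
    proof (intro add_mono mult_left_mono mult_right_mono M0)
      have "\<alpha> * \<tau> \<le> exp (\<alpha> * \<tau>)" using exp_ge_add_one_self[of "\<alpha> * \<tau>"] by linarith
      then show "exp (- (\<alpha> * \<tau>)) * \<tau> \<le> 1 / \<alpha>"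
        using \<alpha>0 by (simp add: exp_minus field_simps)
    qed (use \<alpha>0 \<tau> in auto)
    finally show ?thesis by simp
  qed
  define \<Phi> where "\<Phi> w = Bcontfun (\<Phi>0 w)" for w
  have app: "apply_bcontfun (\<Phi> w) = \<Phi>0 w" for w
    unfolding \<Phi>_def by (rule Bcontfun_inverse) (rule bcontfun_normI[OF cont\<Phi> bound\<Phi>])
  have contr: "dist (\<Phi> v) (\<Phi> w) \<le> (1/2) * dist v w" for v w
  proof (rule dist_bound)
    fix t
    define \<tau> :: real where "\<tau> = max 0 t"
    have \<tau>: "\<tau> \<ge> 0" by (simp add: \<tau>_def max_def)
    let ?g = "\<lambda>w s. G (exp (\<alpha> * s) *\<^sub>R apply_bcontfun w s)"
    have int: "?g w integrable_on {0..\<tau>}" for w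
      by (intro integrable_continuous_real continuous_on_subset[OF contG]) auto
    \<comment> \<open>The weight turns the bound \<open>L * exp (\<alpha> * s) * dist v w\<close> on the integrands into the factor \<open>L / \<alpha>\<close>.\<close>
    have prim: "((\<lambda>s. L * exp (\<alpha> * s) * dist v w) has_integral
        (L * exp (\<alpha> * \<tau>) / \<alpha> * dist v w - L * exp (\<alpha> * 0) / \<alpha> * dist v w)) {0..\<tau>}"
      by (rule fundamental_theorem_of_calculus[OF \<tau>])
         (use \<alpha>0 in \<open>auto intro!: derivative_eq_intros
            simp: has_real_derivative_iff_has_vector_derivative[symmetric]\<close>)
    have "norm (I v \<tau> - I w \<tau>) = norm (integral {0..\<tau>} (\<lambda>s. ?g v s - ?g w s))"
      by (simp add: I_def integral_diff int)
    also have "\<dots> \<le> integral {0..\<tau>} (\<lambda>s. L * exp (\<alpha> * s) * dist v w)"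
    proof (rule integral_norm_bound_integral)
      show "(\<lambda>s. ?g v s - ?g w s) integrable_on {0..\<tau>}" by (intro integrable_diff int)
      show "(\<lambda>s. L * exp (\<alpha> * s) * dist v w) integrable_on {0..\<tau>}"
        using prim by (auto simp: integrable_on_def)
      fix s
      have "norm (?g v s - ?g w s)
          \<le> L * norm (exp (\<alpha> * s) *\<^sub>R apply_bcontfun v s - exp (\<alpha> * s) *\<^sub>R apply_bcontfun w s)"
        using lipschitz_onD[OF lip] by (simp add: dist_norm)
      also have "\<dots> = L * (exp (\<alpha> * s) * dist (apply_bcontfun v s) (apply_bcontfun w s))"
        by (simp add: dist_norm scaleR_diff_right[symmetric])
      also have "\<dots> \<le> L * (exp (\<alpha> * s) * dist v w)"
        by (intro mult_left_mono dist_bounded L0) auto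
      finally show "norm (?g v s - ?g w s) \<le> L * exp (\<alpha> * s) * dist v w" by simp
    qed
    also have "\<dots> = L * exp (\<alpha> * \<tau>) / \<alpha> * dist v w - L / \<alpha> * dist v w"
      using integral_unique[OF prim] by simp
    also have "\<dots> \<le> L * exp (\<alpha> * \<tau>) / \<alpha> * dist v w" using L0 \<alpha>0 by simp
    finally have *: "norm (I v \<tau> - I w \<tau>) \<le> L * exp (\<alpha> * \<tau>) / \<alpha> * dist v w" .
    have "dist (\<Phi> v t) (\<Phi> w t) = exp (- (\<alpha> * \<tau>)) * norm (I v \<tau> - I w \<tau>)"
      by (simp add: app \<Phi>0_def \<tau>_def[symmetric] dist_norm scaleR_diff_right[symmetric])
    also have "\<dots> \<le> exp (- (\<alpha> * \<tau>)) * (L * exp (\<alpha> * \<tau>) / \<alpha> * dist v w)"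
      using * by (intro mult_left_mono) auto
    also have "\<dots> = L / \<alpha> * dist v w" by (simp add: exp_minus)
    also have "\<dots> \<le> (1/2) * dist v w"
      by (intro mult_right_mono) (use L0 in \<open>auto simp: \<alpha>_def field_simps\<close>)
    finally show "dist (\<Phi> v t) (\<Phi> w t) \<le> (1/2) * dist v w" .
  qed
  obtain w where w: "\<Phi> w = w"
    using banach_fix_type[of "1/2" \<Phi>] contr by auto
  have "exp (\<alpha> * t) *\<^sub>R apply_bcontfun w t = I w t" if "t \<ge> 0" for t
  proof -
    have "apply_bcontfun w t = exp (- (\<alpha> * t)) *\<^sub>R I w t"
      using that app[of w] by (simp add: w \<Phi>0_def max_def)
    then show ?thesis by (simp add: exp_minus)
  qed
  with derI[of _ w] have "(I w has_vector_derivative G (I w t)) (at t within {0..})" if "t \<ge> 0" for t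
    using that by auto
  moreover have "I w 0 = x0" by (simp add: I_def)
  ultimately show ?thesis using that by blast
qed

text \<open>Composing the field with the projection onto a ball makes it bounded and globally Lipschitz
  without changing it inside the ball. If the solution of the modified equation reached the
  sphere, then up to the first such time it would solve the original equation, and the
  a priori bound would keep it strictly inside.\<close>

lemma global_solution_of_apriori_bound:
  fixes G :: "'a::euclidean_space \<Rightarrow> 'a"
  assumes loc: "\<And>R. \<exists>L. L-lipschitz_on (cball 0 R) G"
    and apriori: "\<And>T u. T \<ge> 0 \<Longrightarrow> u 0 = x0 \<Longrightarrow>
      (\<And>t. t \<in> {0..T} \<Longrightarrow> (u has_vector_derivative G (u t)) (at t within {0..T})) \<Longrightarrow>
      norm (u T) \<le> B"
  obtains u where "u 0 = x0"
    and "\<And>t. t \<ge> 0 \<Longrightarrow> (u has_vector_derivative G (u t)) (at t within {0..})"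
proof -
  define R where "R = max B (norm x0) + 1"
  have R: "R > B" "R > norm x0" "R > 0"
    using norm_ge_zero[of x0] by (auto simp: R_def simp del: norm_ge_zero)
  define C where "C = cball (0::'a) R"
  have C: "convex C" "closed C" "C \<noteq> {}" "compact C" using R by (auto simp: C_def)
  obtain L where L: "L-lipschitz_on C G" using loc C_def by blast
  define H where "H x = G (closest_point C x)" for x
  have inC: "closest_point C x \<in> C" for x using C by (intro closest_point_in_set)
  have "L-lipschitz_on UNIV H"
  proof (rule lipschitz_onI)
    show "dist (H x) (H y) \<le> L * dist x y" for x y
    proof -
      have "dist (H x) (H y) \<le> L * dist (closest_point C x) (closest_point C y)"
        unfolding H_def by (rule lipschitz_onD[OF L inC inC])
      also have "\<dots> \<le> L * dist x y"
        using C by (intro mult_left_mono closest_point_lipschitz lipschitz_on_nonneg[OF L])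
      finally show ?thesis .
    qed
  qed (rule lipschitz_on_nonneg[OF L])
  moreover have "bounded (range H)"
  proof (rule bounded_subset)
    show "bounded (G ` C)"
      by (intro compact_imp_bounded compact_continuous_image lipschitz_on_continuous_on[OF L] C)
  qed (use inC in \<open>auto simp: H_def\<close>)
  ultimately obtain u where u0: "u 0 = x0"
    and u: "\<And>t. t \<ge> 0 \<Longrightarrow> (u has_vector_derivative H (u t)) (at t within {0..})"
    using global_solution_of_global_lipschitz[of L H x0] by metis
  have cont: "continuous_on {0..t} (\<lambda>s. norm (u s))" for t
  proof -
    have "continuous_on {0..} u"
      using u by (auto simp: continuous_on_eq_continuous_within
          intro: has_vector_derivative_continuous)
    then show ?thesis by (intro continuous_on_norm) (auto elim: continuous_on_subset)
  qed
  have HG: "H x = G x" if "norm x \<le> R" for x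
    using that by (simp add: H_def closest_point_self C_def)
  have "norm (u t) < R" if "t \<ge> 0" for t
  proof (rule ccontr)
    assume "\<not> norm (u t) < R"
    define S where "S = {s \<in> {0..t}. norm (u s) = R}"
    have hit: "\<exists>s. 0 \<le> s \<and> s \<le> t' \<and> norm (u s) = R" if "t' \<ge> 0" "norm (u t') \<ge> R" for t'
      using IVT'[of "\<lambda>s. norm (u s)" 0 R t'] that cont u0 R by auto
    have "S \<noteq> {}" using hit[of t] \<open>t \<ge> 0\<close> \<open>\<not> norm (u t) < R\<close> by (auto simp: S_def)
    moreover have "compact S"
    proof -
      have "closed S" unfolding S_def
        using continuous_closed_preimage_constant[OF cont[of t], of R] by simp
      then have "compact ({0..t} \<inter> S)" by (intro compact_Int_closed) auto
      moreover have "{0..t} \<inter> S = S" by (auto simp: S_def)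
      ultimately show ?thesis by simp
    qed
    ultimately obtain T where T: "T \<in> S" "\<And>s. s \<in> S \<Longrightarrow> T \<le> s"
      using compact_attains_inf[of S] by auto
    have below: "norm (u s) \<le> R" if "s \<in> {0..T}" for s
    proof (rule ccontr)
      assume "\<not> norm (u s) \<le> R"
      with that hit[of s] obtain s' where "0 \<le> s'" "s' \<le> s" "norm (u s') = R" by auto
      then have "T \<le> s'" using T that by (auto simp: S_def)
      with that \<open>s' \<le> s\<close> have "s' = s" by auto
      with \<open>norm (u s') = R\<close> \<open>\<not> norm (u s) \<le> R\<close> show False by simp
    qed
    have "norm (u T) \<le> B"
    proof (rule apriori)
      show "T \<ge> 0" using T by (auto simp: S_def)
      show "(u has_vector_derivative G (u s)) (at s within {0..T})" if "s \<in> {0..T}" for s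
        using has_vector_derivative_within_subset[OF u[of s], of "{0..T}"] that HG[OF below[OF that]]
        by auto
    qed (rule u0)
    with T R show False by (auto simp: S_def)
  qed
  with u HG have "(u has_vector_derivative G (u t)) (at t within {0..})" if "t \<ge> 0" for t
    using that by (metis less_imp_le)
  with u0 that show ?thesis by blast
qed

section \<open>Maps that are Lipschitz on bounded sets\<close>

text \<open>This is the regularity needed for truncating a vector field. In contrast to global Lipschitz
  continuity it is preserved by products.\<close>

definition lipschitz_on_balls :: "('a::real_normed_vector \<Rightarrow> 'b::real_normed_vector) \<Rightarrow> bool" where
  "lipschitz_on_balls g \<longleftrightarrow> (\<forall>R. \<exists>L. L-lipschitz_on (cball 0 R) g)"

lemma lipschitz_on_ballsE:
  assumes "lipschitz_on_balls g"
  obtains L M where "L-lipschitz_on (cball 0 R) g" "\<And>x. norm x \<le> R \<Longrightarrow> norm (g x) \<le> M"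
proof -
  obtain L where L: "L-lipschitz_on (cball 0 R) g"
    using assms by (auto simp: lipschitz_on_balls_def)
  have "norm (g x) \<le> norm (g 0) + L * R" if "norm x \<le> R" for x
  proof -
    have "norm (g x - g 0) \<le> L * norm (x - 0)"
      using that norm_ge_zero[of x] by (intro lipschitz_on_normD[OF L]) (auto simp del: norm_ge_zero)
    also have "\<dots> \<le> L * R" using that lipschitz_on_nonneg[OF L] by (simp add: mult_left_mono)
    finally show ?thesis using norm_triangle_sub[of "g x" "g 0"] by linarith
  qed
  with L that show ?thesis by blast
qed

lemma lipschitz_on_balls_of_lipschitz: "L-lipschitz_on UNIV g \<Longrightarrow> lipschitz_on_balls g"
  unfolding lipschitz_on_balls_def by (meson lipschitz_on_subset subset_UNIV)

lemma lipschitz_on_balls_const: "lipschitz_on_balls (\<lambda>x. c)"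
  by (rule lipschitz_on_balls_of_lipschitz[OF lipschitz_on_constant])

lemma lipschitz_on_balls_linear: "bounded_linear g \<Longrightarrow> lipschitz_on_balls g"
  using bounded_linear.lipschitz_boundE lipschitz_on_balls_of_lipschitz by blast

lemma lipschitz_on_balls_compose:
  assumes g: "lipschitz_on_balls g" and h: "lipschitz_on_balls h"
  shows "lipschitz_on_balls (\<lambda>x. g (h x))"
  unfolding lipschitz_on_balls_def
proof
  fix R
  obtain L M where L: "L-lipschitz_on (cball 0 R) h" and M: "\<And>x. norm x \<le> R \<Longrightarrow> norm (h x) \<le> M"
    using lipschitz_on_ballsE[OF h, of R] by blast
  obtain L' where "L'-lipschitz_on (cball 0 M) g" using g by (auto simp: lipschitz_on_balls_def)
  then have "L'-lipschitz_on (h ` cball 0 R) g" by (rule lipschitz_on_subset) (use M in auto)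
  from lipschitz_on_compose2[OF L this]
  show "\<exists>L. L-lipschitz_on (cball 0 R) (\<lambda>x. g (h x))" by blast
qed

lemma lipschitz_on_balls_add:
  assumes "lipschitz_on_balls g" "lipschitz_on_balls h"
  shows "lipschitz_on_balls (\<lambda>x. g x + h x)"
  using assms unfolding lipschitz_on_balls_def by (blast intro: lipschitz_on_add)

lemma lipschitz_on_balls_minus:
  "lipschitz_on_balls g \<Longrightarrow> lipschitz_on_balls (\<lambda>x. - g x)"
  unfolding lipschitz_on_balls_def by simp

lemma lipschitz_on_balls_diff:
  assumes "lipschitz_on_balls g" "lipschitz_on_balls h"
  shows "lipschitz_on_balls (\<lambda>x. g x - h x)"
  using assms unfolding lipschitz_on_balls_def by (blast intro: lipschitz_on_diff)

lemma lipschitz_on_balls_Pair: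
  assumes "lipschitz_on_balls g" "lipschitz_on_balls h"
  shows "lipschitz_on_balls (\<lambda>x. (g x, h x))"
  using assms unfolding lipschitz_on_balls_def by (blast intro: lipschitz_on_Pair)

lemma lipschitz_on_balls_sum:
  "(\<And>i. i \<in> I \<Longrightarrow> lipschitz_on_balls (g i)) \<Longrightarrow> lipschitz_on_balls (\<lambda>x. \<Sum>i\<in>I. g i x)"
  by (induction I rule: infinite_finite_induct)
     (auto intro: lipschitz_on_balls_const lipschitz_on_balls_add)

lemma lipschitz_on_balls_mult:
  fixes g h :: "'a::real_normed_vector \<Rightarrow> real"
  assumes g: "lipschitz_on_balls g" and h: "lipschitz_on_balls h"
  shows "lipschitz_on_balls (\<lambda>x. g x * h x)"
  unfolding lipschitz_on_balls_def
proof
  fix R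
  obtain L M where L: "L-lipschitz_on (cball 0 R) g" and M: "\<And>x. norm x \<le> R \<Longrightarrow> norm (g x) \<le> M"
    using lipschitz_on_ballsE[OF g, of R] by blast
  obtain L' M' where L': "L'-lipschitz_on (cball 0 R) h" and M': "\<And>x. norm x \<le> R \<Longrightarrow> norm (h x) \<le> M'"
    using lipschitz_on_ballsE[OF h, of R] by blast
  have "(\<bar>M\<bar> * L' + \<bar>M'\<bar> * L)-lipschitz_on (cball 0 R) (\<lambda>x. g x * h x)"
  proof (rule lipschitz_onI)
    fix x y :: 'a assume x: "x \<in> cball 0 R" and y: "y \<in> cball 0 R"
    have "\<bar>g x * h x - g y * h y\<bar> = \<bar>g x * (h x - h y) + h y * (g x - g y)\<bar>"
      by (simp add: algebra_simps)
    also have "\<dots> \<le> \<bar>g x\<bar> * \<bar>h x - h y\<bar> + \<bar>h y\<bar> * \<bar>g x - g y\<bar>"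
      by (metis abs_mult abs_triangle_ineq)
    also have "\<dots> \<le> \<bar>M\<bar> * (L' * dist x y) + \<bar>M'\<bar> * (L * dist x y)"
      using lipschitz_onD[OF L x y] lipschitz_onD[OF L' x y] M[of x] M'[of y] x y
      by (intro add_mono mult_mono) (auto simp: dist_real_def)
    finally show "dist (g x * h x) (g y * h y) \<le> (\<bar>M\<bar> * L' + \<bar>M'\<bar> * L) * dist x y"
      by (simp add: dist_real_def algebra_simps)
  qed (use lipschitz_on_nonneg[OF L] lipschitz_on_nonneg[OF L'] in auto)
  then show "\<exists>L. L-lipschitz_on (cball 0 R) (\<lambda>x. g x * h x)" by blast
qed

lemma lipschitz_on_balls_vec:
  fixes g :: "'n::finite \<Rightarrow> 'a::real_normed_vector \<Rightarrow> 'b::real_normed_vector"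
  assumes "\<And>i. lipschitz_on_balls (g i)"
  shows "lipschitz_on_balls (\<lambda>x. \<chi> i. g i x)"
  unfolding lipschitz_on_balls_def
proof
  fix R
  have "\<forall>i. \<exists>L. L-lipschitz_on (cball 0 R) (g i)"
    using assms by (auto simp: lipschitz_on_balls_def)
  then obtain L where L: "\<And>i. (L i)-lipschitz_on (cball 0 R) (g i)" by metis
  have "(\<Sum>i\<in>UNIV. L i)-lipschitz_on (cball 0 R) (\<lambda>x. \<chi> i. g i x)"
  proof (rule lipschitz_onI)
    fix x y :: 'a assume x: "x \<in> cball 0 R" and y: "y \<in> cball 0 R"
    have "dist (\<chi> i. g i x) (\<chi> i. g i y) \<le> (\<Sum>i\<in>UNIV. dist (g i x) (g i y))"
      by (simp add: dist_vec_def L2_set_le_sum)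
    also have "\<dots> \<le> (\<Sum>i\<in>UNIV. L i * dist x y)"
      using lipschitz_onD[OF L x y] by (intro sum_mono) auto
    finally show "dist (\<chi> i. g i x) (\<chi> i. g i y) \<le> (\<Sum>i\<in>UNIV. L i) * dist x y"
      by (simp add: sum_distrib_right)
  qed (use lipschitz_on_nonneg[OF L] in \<open>auto intro: sum_nonneg\<close>)
  then show "\<exists>L. L-lipschitz_on (cball 0 R) (\<lambda>x. \<chi> i. g i x)" by blast
qed

lemma lipschitz_on_balls_continuously_differentiable:
  fixes g :: "'a::euclidean_space \<Rightarrow> 'b::real_normed_vector"
  assumes "continuously_differentiable g"
  shows "lipschitz_on_balls g"
  unfolding lipschitz_on_balls_def
proof
  fix R
  obtain g' where g': "\<And>x. (g has_derivative blinfun_apply (g' x)) (at x)"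
    and cont: "continuous_on UNIV g'"
    using assms by (auto simp: continuously_differentiable_def)
  have "bounded (g' ` cball 0 R)"
    by (intro compact_imp_bounded compact_continuous_image continuous_on_subset[OF cont]) auto
  then obtain M where M: "norm (g' x) \<le> M" if "x \<in> cball 0 R" for x
    unfolding bounded_iff by blast
  have "\<bar>M\<bar>-lipschitz_on (cball 0 R) g"
  proof (rule lipschitz_onI)
    fix x y :: 'a assume "x \<in> cball 0 R" "y \<in> cball 0 R"
    then have "norm (g x - g y) \<le> \<bar>M\<bar> * norm (x - y)"
      using M by (intro differentiable_bound[where S="cball 0 R" and f'="\<lambda>x. blinfun_apply (g' x)"])
        (auto intro!: has_derivative_at_withinI[OF g'] simp: norm_blinfun.rep_eq[symmetric]
           intro: order_trans[OF _ abs_ge_self])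
    then show "dist (g x) (g y) \<le> \<bar>M\<bar> * dist x y" by (simp add: dist_norm)
  qed simp
  then show "\<exists>L. L-lipschitz_on (cball 0 R) g" by blast
qed

lemma lipschitz_on_balls_sin:
  assumes "lipschitz_on_balls g"
  shows "lipschitz_on_balls (\<lambda>x. sin (g x :: real))"
proof (rule lipschitz_on_balls_compose[OF _ assms])
  have "1-lipschitz_on UNIV (sin :: real \<Rightarrow> real)"
  proof (rule lipschitz_onI)
    show "dist (sin x) (sin y) \<le> 1 * dist x y" for x y :: real
      using field_differentiable_bound[of UNIV sin cos 1 x y] by (simp add: dist_norm)
  qed simp
  then show "lipschitz_on_balls (sin :: real \<Rightarrow> real)" by (rule lipschitz_on_balls_of_lipschitz)
qed

lemmas lipschitz_on_balls_intros =
  lipschitz_on_balls_const lipschitz_on_balls_add lipschitz_on_balls_minus lipschitz_on_balls_diff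
  lipschitz_on_balls_Pair lipschitz_on_balls_sum lipschitz_on_balls_mult lipschitz_on_balls_vec
  lipschitz_on_balls_sin

section \<open>Decreasing functions and convergence\<close>

text \<open>The derivative is taken relative to a time domain \<open>S\<close> that may exceed the interval, so that the
  same statement serves solutions on compact intervals and on the half-line.\<close>

lemma deriv_within_nonpos_imp_antimono:
  fixes V :: "real \<Rightarrow> real"
  assumes S: "{a..b} \<subseteq> S" and ab: "a \<le> b"
    and der: "\<And>t. t \<in> S \<Longrightarrow> (V has_real_derivative V' t) (at t within S)"
    and nonpos: "\<And>t. t \<in> S \<Longrightarrow> V' t \<le> 0"
  shows "V b \<le> V a"
proof -
  have d: "(V has_real_derivative V' t) (at t within {a..b})" if "t \<in> {a..b}" for t
    using DERIV_subset[OF der S] that S by auto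
  show ?thesis
  proof (rule DERIV_nonpos_imp_decreasing_open[OF ab])
    fix t assume t: "a < t" "t < b"
    with d[of t] show "\<exists>y. DERIV V t :> y \<and> y \<le> 0"
      using nonpos[of t] S by (auto simp: at_within_Icc_at subset_iff intro!: exI[of _ "V' t"])
  qed (rule DERIV_continuous_on[OF d])
qed

text \<open>If \<open>h\<close> were at least \<open>\<epsilon>\<close> at arbitrarily late times, then, having a bounded derivative, it
  would be at least \<open>\<epsilon> / 2\<close> on intervals of a fixed length following these times, and \<open>V\<close> would
  lose a fixed amount on each of them. But \<open>V\<close> is decreasing and bounded below, so it can lose
  only arbitrarily little after a late time.\<close>

lemma barbalat:
  fixes V V' h h' :: "real \<Rightarrow> real"
  assumes derV: "\<And>t. t \<ge> 0 \<Longrightarrow> (V has_real_derivative V' t) (at t within {0..})"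
    and decay: "\<And>t. t \<ge> 0 \<Longrightarrow> V' t \<le> - c * (h t)\<^sup>2"
    and c: "c > 0"
    and below: "\<And>t. t \<ge> 0 \<Longrightarrow> V t \<ge> v"
    and derh: "\<And>t. t \<ge> 0 \<Longrightarrow> (h has_real_derivative h' t) (at t within {0..})"
    and bdd: "\<And>t. t \<ge> 0 \<Longrightarrow> \<bar>h' t\<bar> \<le> K"
  shows "(h \<longlongrightarrow> 0) at_top"
proof (rule tendstoI)
  fix \<epsilon> :: real assume \<epsilon>: "\<epsilon> > 0"
  have K0: "K \<ge> 0" using bdd[of 0] by auto
  have mono: "V t \<le> V s" if "0 \<le> s" "s \<le> t" for s t
  proof (rule deriv_within_nonpos_imp_antimono[where S="{0..}" and V=V and V'=V'])
    show "V' t \<le> 0" if "t \<in> {0..}" for t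
      using order_trans[OF decay[of t]] that mult_nonneg_nonneg[of c "(h t)\<^sup>2"] c by simp
  qed (use that derV in auto)
  define d where "d = \<epsilon> / (2 * (K + 1))"
  have d: "d > 0" using \<epsilon> K0 by (simp add: d_def)
  \<comment> \<open>The loss of \<open>V\<close> over an interval of length \<open>d\<close> on which \<open>\<bar>h\<bar> \<ge> \<epsilon> / 2\<close>.\<close>
  define q where "q = c * (\<epsilon>/2)\<^sup>2 * d"
  have q: "q > 0" using c \<epsilon> d by (simp add: q_def)
  have bb: "bdd_below (V ` {0..})" using below by (auto intro!: bdd_belowI)
  define I where "I = Inf (V ` {0..})"
  have "\<exists>v \<in> V ` {0..}. v < I + q"
    using q cInf_lessD[of "V ` {0..}" "I + q"] by (auto simp: I_def)
  then obtain t0 where t0: "t0 \<ge> 0" "V t0 < I + q" by auto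
  have Ile: "I \<le> V t" if "t \<ge> 0" for t
    unfolding I_def using that bb by (intro cInf_lower) auto
  have "\<bar>h t\<bar> < \<epsilon>" if "t \<ge> t0" for t
  proof (rule ccontr)
    assume big: "\<not> \<bar>h t\<bar> < \<epsilon>"
    have t: "t \<ge> 0" using that t0 by simp
    have big': "\<bar>h s\<bar> \<ge> \<epsilon> / 2" if "s \<in> {t..t + d}" for s
    proof -
      have "norm (h s - h t) \<le> K * norm (s - t)"
        by (rule field_differentiable_bound[where S="{0..}" and f'=h'])
           (use derh bdd t that in auto)
      also have "\<dots> \<le> K * d" using that K0 by (intro mult_left_mono) auto
      also have "\<dots> \<le> \<epsilon> / 2" using \<epsilon> K0 by (simp add: d_def field_simps)
      finally have "\<bar>h s - h t\<bar> \<le> \<epsilon> / 2" by simp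
      with big show ?thesis by linarith
    qed
    have "V (t + d) + c * (\<epsilon>/2)\<^sup>2 * (t + d) \<le> V t + c * (\<epsilon>/2)\<^sup>2 * t"
    proof (rule deriv_within_nonpos_imp_antimono[where S="{t..t+d}"
          and V="\<lambda>s. V s + c * (\<epsilon>/2)\<^sup>2 * s" and V'="\<lambda>s. V' s + c * (\<epsilon>/2)\<^sup>2"])
      fix s assume s: "s \<in> {t..t + d}"
      have "(V has_real_derivative V' s) (at s within {t..t+d})"
        using DERIV_subset[OF derV[of s], of "{t..t+d}"] s t by auto
      then show "((\<lambda>a. V a + c * (\<epsilon>/2)\<^sup>2 * a) has_real_derivative V' s + c * (\<epsilon>/2)\<^sup>2)
          (at s within {t..t+d})"
        by (auto intro!: derivative_eq_intros)
      have "(\<epsilon>/2)\<^sup>2 \<le> (h s)\<^sup>2"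
        using big'[OF s] \<epsilon> power_mono[of "\<epsilon>/2" "\<bar>h s\<bar>" 2] by simp
      then have "c * (\<epsilon>/2)\<^sup>2 \<le> c * (h s)\<^sup>2" using c by (intro mult_left_mono) auto
      then show "V' s + c * (\<epsilon>/2)\<^sup>2 \<le> 0" using decay[of s] s t by simp
    qed (use d in auto)
    then have "V (t + d) + q \<le> V t" by (simp add: q_def algebra_simps)
    moreover have "V t \<le> V t0" using mono t0 that by simp
    moreover have "I \<le> V (t + d)" using Ile t d by simp
    ultimately show False using t0 by simp
  qed
  then show "eventually (\<lambda>t. dist (h t) 0 < \<epsilon>) at_top"
    by (auto simp: eventually_at_top_linorder)
qed

section \<open>The Nussbaum gain\<close>

definition nussbaum_primitive :: "real \<Rightarrow> real \<Rightarrow> real" where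
  "nussbaum_primitive \<beta> k = \<beta> * (2 * k * sin k + 2 * cos k - k\<^sup>2 * cos k) + k"

lemma has_real_derivative_nussbaum_primitive:
  "(nussbaum_primitive \<beta> has_real_derivative \<beta> * nussbaum k + 1) (at k)"
  unfolding nussbaum_primitive_def nussbaum_def
  by (auto intro!: derivative_eq_intros simp: algebra_simps power2_eq_square)

lemma continuous_nussbaum_primitive: "continuous_on UNIV (nussbaum_primitive \<beta>)"
  by (intro continuous_at_imp_continuous_on ballI DERIV_isCont[OF has_real_derivative_nussbaum_primitive])

text \<open>The dominant term \<open>- \<beta> * k\<^sup>2 * cos k\<close> is negative at the multiples of \<open>pi\<close> at which the cosine has the sign of
  \<open>\<beta>\<close>: the even ones if \<open>\<beta> > 0\<close> and the odd ones otherwise. These points are symmetric about 0,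
  so one large multiple serves both directions.\<close>

lemma nussbaum_primitive_below:
  assumes "\<beta> \<noteq> 0"
  obtains \<kappa> where "\<kappa> > r" "nussbaum_primitive \<beta> \<kappa> < - M" "nussbaum_primitive \<beta> (- \<kappa>) < - M"
proof -
  define \<rho> where "\<rho> = max (max 0 r) (max (2 / \<bar>\<beta>\<bar>) (M + 2 * \<bar>\<beta>\<bar>))"
  obtain n :: nat where n: "\<rho> < real n" using reals_Archimedean2 by blast
  define \<kappa> where "\<kappa> = (if \<beta> > 0 then 2 * real n * pi else (2 * real n + 1) * pi)"
  have "real n * 1 \<le> real n * (2 * pi)" using pi_gt3 by (intro mult_left_mono) auto
  then have "\<kappa> \<ge> real n"
    unfolding \<kappa>_def by (cases "\<beta> > 0") (simp_all add: algebra_simps, use pi_gt_zero in linarith)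
  with n have \<kappa>: "\<kappa> > 0" "\<kappa> > r" "\<kappa> > 2 / \<bar>\<beta>\<bar>" "\<kappa> > M + 2 * \<bar>\<beta>\<bar>"
    unfolding \<rho>_def by linarith+
  have trig: "sin \<kappa> = 0" "\<beta> * cos \<kappa> = \<bar>\<beta>\<bar>"
  proof -
    have "(2 * real n + 1) * pi = real (2 * n + 1) * pi" by simp
    moreover have "2 * real n * pi = real (2 * n) * pi" by simp
    ultimately show "sin \<kappa> = 0" "\<beta> * cos \<kappa> = \<bar>\<beta>\<bar>"
      unfolding \<kappa>_def by (auto simp only: sin_npi cos_npi split: if_split) auto
  qed
  have "\<kappa> * 1 \<le> \<kappa> * (\<bar>\<beta>\<bar> * \<kappa> - 1)"
    using \<kappa>(1,3) assms by (intro mult_left_mono) (auto simp: field_simps)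
  then have *: "\<bar>\<beta>\<bar> * (2 - \<kappa>\<^sup>2) + \<kappa> < - M"
    using \<kappa>(4) by (simp add: algebra_simps power2_eq_square)
  have val: "nussbaum_primitive \<beta> \<kappa> = \<bar>\<beta>\<bar> * (2 - \<kappa>\<^sup>2) + \<kappa>"
    "nussbaum_primitive \<beta> (- \<kappa>) = \<bar>\<beta>\<bar> * (2 - \<kappa>\<^sup>2) - \<kappa>"
    by (simp_all add: nussbaum_primitive_def trig(1) trig(2)[symmetric] algebra_simps)
  show ?thesis using that[OF \<kappa>(2)] * \<kappa>(1) by (simp add: val)
qed

text \<open>A continuous function that starts between two points at which the primitive is below \<open>- M\<close> cannot
  pass them. The bound depends on the initial value and on \<open>M\<close> only, not on the length of the
  time interval.\<close>

lemma nussbaum_gain_bounded: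
  assumes "\<beta> \<noteq> 0"
  shows "\<exists>K. \<forall>(T::real) k. continuous_on {0..T} k \<longrightarrow> k 0 = k0 \<longrightarrow>
      (\<forall>s\<in>{0..T}. nussbaum_primitive \<beta> (k s) \<ge> - M) \<longrightarrow> (\<forall>t\<in>{0..T}. \<bar>k t\<bar> \<le> K)"
proof -
  obtain \<kappa> where \<kappa>: "\<kappa> > \<bar>k0\<bar>" "nussbaum_primitive \<beta> \<kappa> < - M" "nussbaum_primitive \<beta> (- \<kappa>) < - M"
    using nussbaum_primitive_below[OF assms] .
  have "\<bar>k t\<bar> \<le> \<kappa>"
    if "continuous_on {0..T} k" "k 0 = k0"
      "\<forall>s\<in>{0..T}. nussbaum_primitive \<beta> (k s) \<ge> - M" and t: "t \<in> {0..T}" for T t :: real and k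
  proof (rule ccontr)
    assume "\<not> \<bar>k t\<bar> \<le> \<kappa>"
    moreover have "continuous_on {0..t} k" using t by (intro continuous_on_subset[OF that(1)]) auto
    ultimately have "\<exists>s. 0 \<le> s \<and> s \<le> t \<and> \<bar>k s\<bar> = \<kappa>"
      using IVT'[of "\<lambda>s. \<bar>k s\<bar>" 0 \<kappa> t] that(2) t \<kappa>(1) by (auto intro: continuous_on_rabs)
    then obtain s where "0 \<le> s" "s \<le> t" "\<bar>k s\<bar> = \<kappa>" by blast
    with t have s: "s \<in> {0..T}" "\<bar>k s\<bar> = \<kappa>" by auto
    then have "k s = \<kappa> \<or> k s = - \<kappa>" by (auto simp: abs_if split: if_splits)
    with bspec[OF that(3) s(1)] \<kappa> show False by auto
  qed
  then show ?thesis by blast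
qed

section \<open>The state space of the closed loop\<close>

type_synonym 'n closed_loop_state =
  "(real ^ 'n) \<times> (real ^ 'n) \<times> (real ^ 'n) \<times> (real ^ 'n) \<times> (real ^ 'n ^ 'n) \<times> (real ^ 'n ^ 'n)"

lemma bounded_linear_state_projections:
  "bounded_linear (\<lambda>u::'n::finite closed_loop_state. fst u $ i)"
  "bounded_linear (\<lambda>u::'n closed_loop_state. fst (snd u) $ i)"
  "bounded_linear (\<lambda>u::'n closed_loop_state. fst (snd (snd u)) $ i)"
  "bounded_linear (\<lambda>u::'n closed_loop_state. fst (snd (snd (snd u))) $ i)"
  "bounded_linear (\<lambda>u::'n closed_loop_state. fst (snd (snd (snd (snd u)))) $ i)"
  "bounded_linear (\<lambda>u::'n closed_loop_state. fst (snd (snd (snd (snd u)))) $ i $ j)"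
  "bounded_linear (\<lambda>u::'n closed_loop_state. snd (snd (snd (snd (snd u)))) $ i $ j)"
  by (intro bounded_linear_compose[OF bounded_linear_vec_nth] bounded_linear_fst_comp
      bounded_linear_snd_comp bounded_linear_ident)+

section \<open>The Laplacian of a connected graph pinned at a neighbourhood\<close>

text \<open>For fixed \<open>j\<close> this is the map that sends the gaps between the estimates of \<open>y j\<close> and \<open>y j\<close> itself to the
  consensus errors: the Laplacian of the graph, pinned at the neighbours of \<open>j\<close>, which are the players
  that receive \<open>y j\<close> directly.\<close>

definition pinned_laplacian :: "('n::finite \<Rightarrow> 'n \<Rightarrow> real) \<Rightarrow> 'n \<Rightarrow> real ^ 'n \<Rightarrow> real ^ 'n" where
  "pinned_laplacian A j v = (\<chi> i. (\<Sum>k\<in>UNIV. A i k * (v $ i - v $ k)) + A i j * v $ i)"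

lemma linear_pinned_laplacian: "linear (pinned_laplacian A j)"
  by (rule linearI)
     (auto simp: pinned_laplacian_def vec_eq_iff sum.distrib[symmetric] sum_distrib_left
        algebra_simps intro!: sum.cong)

lemma inner_pinned_laplacian_commute:
  assumes sym: "\<And>i k. A i k = A k i"
  shows "v \<bullet> pinned_laplacian A j w = w \<bullet> pinned_laplacian A j v"
proof -
  have expand: "v \<bullet> pinned_laplacian A j w = (\<Sum>i\<in>UNIV. \<Sum>k\<in>UNIV. A i k * v $ i * w $ i)
      - (\<Sum>i\<in>UNIV. \<Sum>k\<in>UNIV. A i k * v $ i * w $ k) + (\<Sum>i\<in>UNIV. A i j * v $ i * w $ i)" for v w
    by (simp add: inner_vec_def pinned_laplacian_def sum.distrib[symmetric]
        sum_subtractf[symmetric] sum_distrib_left algebra_simps)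
  have "(\<Sum>i\<in>UNIV. \<Sum>k\<in>UNIV. A i k * v $ i * w $ k) = (\<Sum>k\<in>UNIV. \<Sum>i\<in>UNIV. A k i * w $ k * v $ i)"
    by (subst sum.swap) (simp add: sym mult_ac)
  then show ?thesis by (simp add: expand mult_ac)
qed

lemma inner_pinned_laplacian_self:
  assumes sym: "\<And>i k. A i k = A k i"
  shows "v \<bullet> pinned_laplacian A j v =
    (\<Sum>i\<in>UNIV. \<Sum>k\<in>UNIV. A i k * (v $ i - v $ k)\<^sup>2) / 2 + (\<Sum>i\<in>UNIV. A i j * (v $ i)\<^sup>2)"
proof -
  let ?S = "\<Sum>i\<in>UNIV. \<Sum>k\<in>UNIV. A i k * v $ i * (v $ i - v $ k)"
  have "v \<bullet> pinned_laplacian A j v = ?S + (\<Sum>i\<in>UNIV. A i j * (v $ i)\<^sup>2)"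
    by (simp add: inner_vec_def pinned_laplacian_def sum.distrib[symmetric]
        sum_distrib_left algebra_simps power2_eq_square)
  moreover have "?S = (\<Sum>i\<in>UNIV. \<Sum>k\<in>UNIV. A i k * v $ k * (v $ k - v $ i))"
    by (subst sum.swap) (simp add: sym)
  then have "?S + ?S = ?S + (\<Sum>i\<in>UNIV. \<Sum>k\<in>UNIV. A i k * v $ k * (v $ k - v $ i))" by simp
  then have "?S + ?S = (\<Sum>i\<in>UNIV. \<Sum>k\<in>UNIV. A i k * (v $ i - v $ k)\<^sup>2)"
    by (simp only: sum.distrib[symmetric]) (simp add: algebra_simps power2_eq_square)
  ultimately show ?thesis by simp
qed

text \<open>If the form vanishes at \<open>v\<close>, then \<open>v\<close> is constant along edges and zero at the
  neighbours of \<open>j\<close>. With at least two players, connectedness supplies a neighbour of \<open>j\<close> and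
  carries the value 0 from it to every vertex.\<close>

lemma pinned_laplacian_pos:
  fixes A :: "'n::finite \<Rightarrow> 'n \<Rightarrow> real"
  assumes "CARD('n) \<ge> 2" and adj: "adjacency_matrix E A" and und: "undirected_graph E A"
    and conn: "connected_graph E" and v: "v \<noteq> 0"
  shows "v \<bullet> pinned_laplacian A j v > 0"
proof (rule ccontr)
  assume "\<not> v \<bullet> pinned_laplacian A j v > 0"
  have sym: "A i k = A k i" for i k using und by (auto simp: undirected_graph_def)
  have nonneg: "A i k \<ge> 0" for i k
    using adj unfolding adjacency_matrix_def by (cases "(k, i) \<in> E") (auto intro: less_imp_le)
  have edge: "A i k > 0" if "(k, i) \<in> E" for i k using adj that by (auto simp: adjacency_matrix_def)
  let ?S = "\<lambda>i. \<Sum>k\<in>UNIV. A i k * (v $ i - v $ k)\<^sup>2"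
  have nn: "?S i \<ge> 0" "A i j * (v $ i)\<^sup>2 \<ge> 0" for i using nonneg by (auto intro!: sum_nonneg)
  have "(\<Sum>i\<in>UNIV. ?S i) \<ge> 0" "(\<Sum>i\<in>UNIV. A i j * (v $ i)\<^sup>2) \<ge> 0"
    by (intro sum_nonneg nn)+
  with \<open>\<not> _ > 0\<close> have "(\<Sum>i\<in>UNIV. ?S i) = 0" "(\<Sum>i\<in>UNIV. A i j * (v $ i)\<^sup>2) = 0"
    unfolding inner_pinned_laplacian_self[of A, OF sym] by linarith+
  then have zero: "?S i = 0" "A i j * (v $ i)\<^sup>2 = 0" for i
    using nn by (simp_all add: sum_nonneg_eq_0_iff)
  have "A i k * (v $ i - v $ k)\<^sup>2 = 0" for i k
    using zero(1)[of i] nonneg by (subst (asm) sum_nonneg_eq_0_iff) auto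
  then have eq: "v $ i = v $ k" if "(k, i) \<in> E" for i k
    using edge[OF that] by (metis less_irrefl mult_eq_0_iff power2_eq_square right_minus_eq)
  obtain i where "i \<noteq> j"
  proof -
    have "card {j} < CARD('n)" using assms(1) by simp
    then have "UNIV \<noteq> {j}" by force
    then show ?thesis using that by blast
  qed
  then have "(j, i) \<in> E\<^sup>+" using conn by (auto simp: connected_graph_def)
  then obtain p where p: "(j, p) \<in> E" by (meson tranclD)
  then have vp: "v $ p = 0" using zero(2)[of p] edge[OF p] by auto
  have "v $ q = 0" for q
  proof (cases "q = p")
    case False
    then have "(p, q) \<in> E\<^sup>+" using conn by (auto simp: connected_graph_def)
    then show ?thesis by (induction rule: trancl_induct) (use eq vp in auto)
  qed (use vp in simp)
  then show False using v by (simp add: vec_eq_iff)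
qed

text \<open>The form attains its minimum on the compact unit sphere; homogeneity does the rest.\<close>

lemma quadratic_form_coercive:
  fixes H :: "'a::euclidean_space \<Rightarrow> 'a"
  assumes lin: "linear H" and pos: "\<And>v. v \<noteq> 0 \<Longrightarrow> v \<bullet> H v > 0"
  obtains c where "c > 0" "\<And>v. c * (norm v)\<^sup>2 \<le> v \<bullet> H v"
proof -
  have cont: "continuous_on (sphere 0 1) (\<lambda>v. v \<bullet> H v)"
    using linear_continuous_on[OF linear_conv_bounded_linear[THEN iffD1, OF lin]]
    by (intro continuous_intros)
  have "sphere (0::'a) 1 \<noteq> {}" using vector_choose_size[of 1] by auto
  then obtain w :: 'a where w: "norm w = 1" "\<And>v. norm v = 1 \<Longrightarrow> w \<bullet> H w \<le> v \<bullet> H v"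
    using continuous_attains_inf[OF compact_sphere _ cont] by auto
  have "w \<bullet> H w * (norm v)\<^sup>2 \<le> v \<bullet> H v" for v
  proof (cases "v = 0")
    case True then show ?thesis using linear_0[OF lin] by simp
  next
    case False
    define u where "u = (1 / norm v) *\<^sub>R v"
    have v: "v = norm v *\<^sub>R u" and u: "norm u = 1" using False by (auto simp: u_def)
    have "v \<bullet> H v = (norm v *\<^sub>R u) \<bullet> H (norm v *\<^sub>R u)" by (simp only: v[symmetric])
    also have "\<dots> = (norm v)\<^sup>2 * (u \<bullet> H u)" by (simp add: linear_scale[OF lin] power2_eq_square)
    finally have "v \<bullet> H v = (norm v)\<^sup>2 * (u \<bullet> H u)" .
    then show ?thesis using mult_right_mono[OF w(2)[OF u], of "(norm v)\<^sup>2"] by (simp add: mult.commute)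
  qed
  moreover have "w \<bullet> H w > 0" using w(1) by (intro pos) auto
  ultimately show ?thesis using that by blast
qed

lemma has_real_derivative_pinned_form:
  assumes sym: "\<And>i k. A i k = A k i"
    and der: "\<And>i. ((\<lambda>s. v s $ i) has_real_derivative v' $ i) (at t within S)"
  shows "((\<lambda>s. v s \<bullet> pinned_laplacian A j (v s)) has_real_derivative
      2 * (v' \<bullet> pinned_laplacian A j (v t))) (at t within S)"
proof -
  have "((\<lambda>s. pinned_laplacian A j (v s) $ i) has_real_derivative pinned_laplacian A j v' $ i)
      (at t within S)" for i
    unfolding pinned_laplacian_def vec_lambda_beta
    by (intro DERIV_add DERIV_sum DERIV_cmult DERIV_diff der)
  then have "((\<lambda>s. v s \<bullet> pinned_laplacian A j (v s)) has_real_derivative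
      (\<Sum>i\<in>UNIV. v t $ i * pinned_laplacian A j v' $ i + v' $ i * pinned_laplacian A j (v t) $ i))
      (at t within S)"
    unfolding inner_vec_def inner_real_def by (intro DERIV_sum DERIV_mult' der)
  moreover have "(\<Sum>i\<in>UNIV. v t $ i * pinned_laplacian A j v' $ i + v' $ i * pinned_laplacian A j (v t) $ i)
      = v t \<bullet> pinned_laplacian A j v' + v' \<bullet> pinned_laplacian A j (v t)"
    by (simp add: inner_vec_def sum.distrib)
  ultimately show ?thesis
    using inner_pinned_laplacian_commute[of A "v t" j v', OF sym] by simp
qed

section \<open>The Nash equilibrium of a strongly monotone game\<close>

locale nash_seeking =
  fixes f :: "'n::finite \<Rightarrow> real ^ 'n \<Rightarrow> real"
    and \<phi> :: "'n \<Rightarrow> real \<Rightarrow> real"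
    and b \<theta> l :: "'n \<Rightarrow> real"
    and m :: real
    and E :: "('n \<times> 'n) set"
    and A :: "'n \<Rightarrow> 'n \<Rightarrow> real"
  assumes two_players: "CARD('n) \<ge> 2"
    and b_nonzero: "b i \<noteq> 0"
    and phi_C1: "continuously_differentiable (\<phi> i)"
    and cost_C1: "continuously_differentiable (f i)"
    and cost_lipschitz: "(l i)-lipschitz_on UNIV (partial_deriv i (f i))"
    and m_pos: "m > 0"
    and strongly_monotone:
      "(x - z) \<bullet> (pseudo_gradient f x - pseudo_gradient f z) \<ge> m * (norm (x - z))\<^sup>2"
    and adjacency: "adjacency_matrix E A"
    and undirected: "undirected_graph E A"
    and connected: "connected_graph E"
begin

abbreviation marginal_cost :: "'n \<Rightarrow> real ^ 'n \<Rightarrow> real" where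
  "marginal_cost i \<equiv> partial_deriv i (f i)"

lemma l_nonneg: "l i \<ge> 0"
  using cost_lipschitz by (rule lipschitz_on_nonneg)

lemma marginal_cost_lipschitz:
  "\<bar>marginal_cost i x - marginal_cost i z\<bar> \<le> (\<Sum>k\<in>UNIV. l k) * norm (x - z)"
proof -
  have "\<bar>marginal_cost i x - marginal_cost i z\<bar> \<le> l i * norm (x - z)"
    using lipschitz_on_normD[OF cost_lipschitz[of i], of x z] by simp
  also have "\<dots> \<le> (\<Sum>k\<in>UNIV. l k) * norm (x - z)"
    by (intro mult_right_mono member_le_sum) (auto simp: l_nonneg)
  finally show ?thesis .
qed

text \<open>Rebasing the coordinate line at any of its points does not change the line, so the partial
  derivative at a moved point is the derivative along the original line.\<close>

lemma has_real_derivative_cost: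
  "((\<lambda>s. f i (replace_coord x i s)) has_real_derivative marginal_cost i (replace_coord x i s)) (at s)"
proof -
  obtain f' where f': "\<And>x. (f i has_derivative blinfun_apply (f' x)) (at x)"
    using cost_C1[of i] by (auto simp: continuously_differentiable_def)
  have rep: "replace_coord x i = (\<lambda>s. replace_coord x i 0 + s *\<^sub>R axis i 1)"
    by (auto simp: replace_coord_def fun_eq_iff vec_eq_iff axis_def)
  have "((\<lambda>s. replace_coord x i 0 + s *\<^sub>R axis i 1) has_derivative (\<lambda>h. h *\<^sub>R axis i 1)) (at s)"
    by (auto intro!: derivative_eq_intros)
  then have "(replace_coord x i has_derivative (\<lambda>h. h *\<^sub>R axis i 1)) (at s)"
    by (simp only: rep[symmetric])
  from has_derivative_compose[OF this f']
  have "(\<lambda>s. f i (replace_coord x i s)) differentiable (at s)"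
    unfolding differentiable_def by blast
  then have "((\<lambda>s. f i (replace_coord x i s)) has_real_derivative
      deriv (\<lambda>s. f i (replace_coord x i s)) s) (at s)"
    using DERIV_deriv_iff_real_differentiable by blast
  moreover have "replace_coord (replace_coord x i s) i = replace_coord x i"
    by (auto simp: replace_coord_def fun_eq_iff vec_eq_iff)
  moreover have "replace_coord x i s $ i = s" by (simp add: replace_coord_def)
  ultimately show ?thesis by (simp add: partial_deriv_def)
qed

text \<open>Strong monotonicity applied to two points that differ only in coordinate \<open>i\<close> shows that the marginal cost of
  player \<open>i\<close> increases with its own action. A stationary action therefore
  minimises the cost globally.\<close>

lemma nash_equilibrium_iff_stationary: "nash_equilibrium f x \<longleftrightarrow> pseudo_gradient f x = 0"
proof -
  have self: "replace_coord x i (x $ i) = x" for i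
    by (auto simp: replace_coord_def vec_eq_iff)
  show ?thesis
  proof
    assume ne: "nash_equilibrium f x"
    have "marginal_cost i x = 0" for i
    proof (rule DERIV_local_min[of _ _ "x $ i" 1])
      show "((\<lambda>s. f i (replace_coord x i s)) has_real_derivative marginal_cost i x) (at (x $ i))"
        using has_real_derivative_cost[of i x "x $ i"] by (simp add: self)
    qed (use ne in \<open>auto simp: nash_equilibrium_def self\<close>)
    then show "pseudo_gradient f x = 0" by (simp add: pseudo_gradient_def vec_eq_iff)
  next
    assume stat: "pseudo_gradient f x = 0"
    show "nash_equilibrium f x"
      unfolding nash_equilibrium_def
    proof (intro allI)
      fix i s
      let ?g = "\<lambda>s. f i (replace_coord x i s)" and ?g' = "\<lambda>s. marginal_cost i (replace_coord x i s)"
      have sign: "(r - x $ i) * ?g' r \<ge> 0" for r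
      proof -
        let ?d = "replace_coord x i r - x"
        have "?d \<bullet> pseudo_gradient f (replace_coord x i r) =
            (\<Sum>k\<in>UNIV. if k = i then (r - x $ i) * ?g' r else 0)"
          unfolding inner_vec_def
          by (rule sum.cong) (auto simp: replace_coord_def pseudo_gradient_def)
        then have "(r - x $ i) * ?g' r = ?d \<bullet> (pseudo_gradient f (replace_coord x i r) - pseudo_gradient f x)"
          by (simp add: stat)
        also have "\<dots> \<ge> m * (norm ?d)\<^sup>2" by (rule strongly_monotone)
        finally show ?thesis using m_pos order_trans[OF mult_nonneg_nonneg[of m "(norm ?d)\<^sup>2"]] by simp
      qed
      have cont: "continuous_on S ?g" for S
        by (intro continuous_at_imp_continuous_on ballI DERIV_isCont[OF has_real_derivative_cost])
      show "f i x \<le> f i (replace_coord x i s)"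
      proof (cases "x $ i \<le> s")
        case True
        have "?g (x $ i) \<le> ?g s"
        proof (rule DERIV_nonneg_imp_increasing_open[OF True])
          fix r assume "x $ i < r" "r < s"
          then have "?g' r \<ge> 0" using sign[of r] by (simp add: zero_le_mult_iff)
          then show "\<exists>y. (?g has_real_derivative y) (at r) \<and> y \<ge> 0"
            using has_real_derivative_cost by blast
        qed (rule cont)
        then show ?thesis by (simp add: self)
      next
        case False
        have "?g s \<ge> ?g (x $ i)"
        proof (rule DERIV_nonpos_imp_decreasing_open[of s "x $ i" ?g])
          fix r assume "s < r" "r < x $ i"
          then have "?g' r \<le> 0" using sign[of r] by (simp add: zero_le_mult_iff)
          then show "\<exists>y. (?g has_real_derivative y) (at r) \<and> y \<le> 0"
            using has_real_derivative_cost by blast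
        qed (use False cont in auto)
        then show ?thesis by (simp add: self)
      qed
    qed
  qed
qed

text \<open>A stationary point is a fixed point of the gradient step \<open>x - \<gamma> P x\<close>. For \<open>P\<close> strongly monotone
  with constant \<open>m\<close> and Lipschitz with constant \<open>L\<close>, the step size \<open>\<gamma> = m / L\<^sup>2\<close> minimises the squared contraction
  factor \<open>1 - 2 \<gamma> m + \<gamma>\<^sup>2 L\<^sup>2\<close>, with value \<open>1 - (m / L)\<^sup>2\<close>.\<close>

lemma ex1_stationary: "\<exists>!x. pseudo_gradient f x = 0"
proof -
  \<comment> \<open>The summand \<open>m\<close> ensures \<open>L \<ge> m\<close> and \<open>L > 0\<close>, so that the contraction factor is well defined.\<close>
  define L where "L = real CARD('n) * (\<Sum>k\<in>UNIV. l k) + m"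
  have "(\<Sum>k\<in>UNIV. l k) \<ge> 0" by (intro sum_nonneg) (simp add: l_nonneg)
  then have L: "L > 0" "L \<ge> m" using m_pos by (simp_all add: L_def add_nonneg_pos)
  have PL: "norm (pseudo_gradient f x - pseudo_gradient f z) \<le> L * norm (x - z)" for x z
  proof -
    have "norm (pseudo_gradient f x - pseudo_gradient f z)
        \<le> (\<Sum>i\<in>UNIV. \<bar>marginal_cost i x - marginal_cost i z\<bar>)"
      using norm_le_l1_cart[of "pseudo_gradient f x - pseudo_gradient f z"]
      by (simp add: pseudo_gradient_def)
    also have "\<dots> \<le> (\<Sum>i\<in>(UNIV::'n set). (\<Sum>k\<in>UNIV. l k) * norm (x - z))"
      by (intro sum_mono marginal_cost_lipschitz)
    also have "\<dots> \<le> L * norm (x - z)" using m_pos by (simp add: L_def algebra_simps)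
    finally show ?thesis .
  qed
  define \<gamma> where "\<gamma> = m / L\<^sup>2"
  have \<gamma>: "\<gamma> > 0" using m_pos L by (simp add: \<gamma>_def)
  define F where "F x = x - \<gamma> *\<^sub>R pseudo_gradient f x" for x
  define q where "q = 1 - (m / L)\<^sup>2"
  have "m / L \<le> 1" "m / L > 0" using m_pos L by (auto simp: field_simps)
  then have q: "0 \<le> q" "q < 1" by (auto simp: q_def power_le_one)
  have "dist (F x) (F z) \<le> sqrt q * dist x z" for x z
  proof -
    let ?d = "x - z" and ?p = "pseudo_gradient f x - pseudo_gradient f z"
    have "(norm (F x - F z))\<^sup>2 = (norm (?d - \<gamma> *\<^sub>R ?p))\<^sup>2"
      by (simp add: F_def algebra_simps)
    also have "\<dots> = (norm ?d)\<^sup>2 - 2 * \<gamma> * (?d \<bullet> ?p) + \<gamma>\<^sup>2 * (norm ?p)\<^sup>2"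
      unfolding power2_norm_eq_inner
      by (simp add: inner_diff_left inner_diff_right inner_commute algebra_simps power2_eq_square)
    also have "\<dots> \<le> (norm ?d)\<^sup>2 - 2 * \<gamma> * (m * (norm ?d)\<^sup>2) + \<gamma>\<^sup>2 * (L * norm ?d)\<^sup>2"
      using \<gamma> by (intro add_mono diff_mono mult_left_mono strongly_monotone power_mono PL) auto
    also have "\<dots> = (1 - 2 * \<gamma> * m + \<gamma>\<^sup>2 * L\<^sup>2) * (norm ?d)\<^sup>2"
      by (simp add: algebra_simps power_mult_distrib)
    also have "1 - 2 * \<gamma> * m + \<gamma>\<^sup>2 * L\<^sup>2 = q"
      using L by (simp add: \<gamma>_def q_def field_simps power2_eq_square)
    also have "q * (norm ?d)\<^sup>2 = (sqrt q * norm ?d)\<^sup>2" using q by (simp add: power_mult_distrib)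
    finally show ?thesis unfolding dist_norm by (rule power2_le_imp_le) (use q in auto)
  qed
  then have "\<exists>!x. F x = x" using q by (intro banach_fix_type[of "sqrt q"]) auto
  then show ?thesis using \<gamma> by (simp add: F_def)
qed

definition equilibrium :: "real ^ 'n" where
  "equilibrium = (THE x. pseudo_gradient f x = 0)"

lemma equilibrium_stationary: "pseudo_gradient f equilibrium = 0"
  unfolding equilibrium_def by (rule theI'[OF ex1_stationary])

lemma nash_equilibrium_iff: "nash_equilibrium f x \<longleftrightarrow> x = equilibrium"
  using nash_equilibrium_iff_stationary equilibrium_stationary ex1_stationary by auto

section \<open>The closed loop on a time interval\<close>

text \<open>The time domain \<open>S\<close> is a parameter because existence rests on bounds for solutions
  on compact intervals.\<close>

definition closed_loop_on ::
  "real set \<Rightarrow> (real \<Rightarrow> real ^ 'n) \<Rightarrow> (real \<Rightarrow> real ^ 'n) \<Rightarrow> (real \<Rightarrow> real ^ 'n) \<Rightarrow> (real \<Rightarrow> real ^ 'n)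
    \<Rightarrow> (real \<Rightarrow> real ^ 'n ^ 'n) \<Rightarrow> (real \<Rightarrow> real ^ 'n ^ 'n) \<Rightarrow> bool" where
  "closed_loop_on S x k \<theta>h y z \<delta> \<longleftrightarrow>
     (\<forall>t\<in>S. \<forall>i.
        ((\<lambda>s. x s $ i) has_real_derivative
           b i * control_input (\<phi> i) (x t $ i) (k t $ i) (\<theta>h t $ i) (y t $ i)
             + \<phi> i (x t $ i) * \<theta> i) (at t within S) \<and>
        ((\<lambda>s. k s $ i) has_real_derivative
           (x t $ i - y t $ i) * (x t $ i - y t $ i + \<phi> i (x t $ i) * \<theta>h t $ i))
           (at t within S) \<and>
        ((\<lambda>s. \<theta>h s $ i) has_real_derivative \<phi> i (x t $ i) * (x t $ i - y t $ i))
           (at t within S) \<and>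
        ((\<lambda>s. y s $ i) has_real_derivative - marginal_cost i (z t $ i)) (at t within S) \<and>
        (\<forall>j. ((\<lambda>s. z s $ i $ j) has_real_derivative
                - (\<delta> t $ i $ j) * consensus_error A (y t) (z t) i j) (at t within S) \<and>
             ((\<lambda>s. \<delta> s $ i $ j) has_real_derivative
                (consensus_error A (y t) (z t) i j)\<^sup>2) (at t within S)))"

lemma closed_loop_solution_iff:
  "closed_loop_solution f \<phi> b \<theta> A x k \<theta>h y z \<delta> \<longleftrightarrow> closed_loop_on {0..} x k \<theta>h y z \<delta>"
  unfolding closed_loop_solution_def closed_loop_on_def Ball_def atLeast_iff by (rule refl)

lemma closed_loop_onD:
  assumes "closed_loop_on S x k \<theta>h y z \<delta>" "t \<in> S"
  shows "((\<lambda>s. x s $ i) has_real_derivative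
           b i * control_input (\<phi> i) (x t $ i) (k t $ i) (\<theta>h t $ i) (y t $ i)
             + \<phi> i (x t $ i) * \<theta> i) (at t within S)"
    and "((\<lambda>s. k s $ i) has_real_derivative
           (x t $ i - y t $ i) * (x t $ i - y t $ i + \<phi> i (x t $ i) * \<theta>h t $ i)) (at t within S)"
    and "((\<lambda>s. \<theta>h s $ i) has_real_derivative \<phi> i (x t $ i) * (x t $ i - y t $ i)) (at t within S)"
    and "((\<lambda>s. y s $ i) has_real_derivative - marginal_cost i (z t $ i)) (at t within S)"
    and "((\<lambda>s. z s $ i $ j) has_real_derivative
           - (\<delta> t $ i $ j) * consensus_error A (y t) (z t) i j) (at t within S)"
    and "((\<lambda>s. \<delta> s $ i $ j) has_real_derivative (consensus_error A (y t) (z t) i j)\<^sup>2) (at t within S)"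
  using assms unfolding closed_loop_on_def by blast+

definition estimate_gap :: "real ^ 'n \<Rightarrow> real ^ 'n ^ 'n \<Rightarrow> 'n \<Rightarrow> real ^ 'n" where
  "estimate_gap y z j = (\<chi> i. z $ i $ j - y $ j)"

lemma consensus_error_eq:
  "consensus_error A y z i j = pinned_laplacian A j (estimate_gap y z j) $ i"
  by (simp add: consensus_error_def pinned_laplacian_def estimate_gap_def)

lemma adjacency_sym: "A i k = A k i"
  using undirected by (auto simp: undirected_graph_def)

lemma pinned_laplacian_coercive:
  obtains c where "c > 0" "\<And>j v. c * (norm v)\<^sup>2 \<le> v \<bullet> pinned_laplacian A j v"
    "\<And>j v. c * norm v \<le> norm (pinned_laplacian A j v)"
proof -
  have "\<exists>c>0. \<forall>v. c * (norm v)\<^sup>2 \<le> v \<bullet> pinned_laplacian A j v" for j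
    using quadratic_form_coercive[OF linear_pinned_laplacian[of A j]]
      pinned_laplacian_pos[OF two_players adjacency undirected connected] by metis
  then obtain c where c: "\<And>j. c j > 0" "\<And>j v. c j * (norm v)\<^sup>2 \<le> v \<bullet> pinned_laplacian A j v"
    by metis
  define c0 where "c0 = Min (range c)"
  have c0: "c0 > 0" "\<And>j. c0 \<le> c j" using c(1) by (auto simp: c0_def)
  have le: "c0 * (norm v)\<^sup>2 \<le> v \<bullet> pinned_laplacian A j v" for j v
    using mult_right_mono[OF c0(2)[of j], of "(norm v)\<^sup>2"] c(2)[of j v] by simp
  have "c0 * norm v \<le> norm (pinned_laplacian A j v)" for j v
  proof (cases "v = 0")
    case False
    have "(c0 * norm v) * norm v \<le> norm (pinned_laplacian A j v) * norm v"
      using order_trans[OF le[of v j] norm_cauchy_schwarz[of v]]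
      by (simp add: power2_eq_square mult_ac)
    then show ?thesis using False by simp
  qed simp
  with c0 le that show ?thesis by blast
qed

section \<open>The energy of the seeking dynamics\<close>

text \<open>The forms \<open>v \<bullet> H v\<close>, rather than \<open>\<bar>v\<bar>\<^sup>2\<close>, measure the estimation error: their derivative is
  \<open>2 * (v' \<bullet> H v)\<close>, and \<open>H v\<close> is the consensus error by which the estimates are driven.\<close>

definition seeking_energy :: "real \<Rightarrow> real ^ 'n \<Rightarrow> real ^ 'n ^ 'n \<Rightarrow> real ^ 'n ^ 'n \<Rightarrow> real" where
  "seeking_energy \<delta>s y z \<delta> = (\<Sum>i\<in>UNIV. (y $ i - equilibrium $ i)\<^sup>2) / 2
     + (\<Sum>j\<in>UNIV. estimate_gap y z j \<bullet> pinned_laplacian A j (estimate_gap y z j)) / 2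
     + (\<Sum>j\<in>UNIV. \<Sum>i\<in>UNIV. (\<delta> $ i $ j - \<delta>s)\<^sup>2) / 2"

text \<open>The derivative of \<open>seeking_energy\<close> along solutions. It does not involve \<open>\<delta>\<close>: the term
  \<open>- \<delta> i j * e\<^sup>2\<close> from the consensus protocol cancels against the derivative
  \<open>(\<delta> i j - \<delta>s) * e\<^sup>2\<close> of the last summand of the energy, up to \<open>- \<delta>s * e\<^sup>2\<close>.\<close>

definition seeking_rate :: "real \<Rightarrow> real ^ 'n \<Rightarrow> real ^ 'n ^ 'n \<Rightarrow> real" where
  "seeking_rate \<delta>s y z = (\<Sum>i\<in>UNIV. - ((y $ i - equilibrium $ i) * marginal_cost i (z $ i)))
     + (\<Sum>j\<in>UNIV. \<Sum>i\<in>UNIV. consensus_error A y z i j * marginal_cost j (z $ j)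
          - \<delta>s * (consensus_error A y z i j)\<^sup>2)"

definition dissipation :: "real ^ 'n \<Rightarrow> real ^ 'n ^ 'n \<Rightarrow> real" where
  "dissipation y z = m / 2 * (norm (y - equilibrium))\<^sup>2
     + (\<Sum>j\<in>UNIV. \<Sum>i\<in>UNIV. (consensus_error A y z i j)\<^sup>2)"

lemma dissipation_nonneg: "dissipation y z \<ge> 0"
  unfolding dissipation_def using m_pos by (intro add_nonneg_nonneg sum_nonneg) auto

lemma has_real_derivative_seeking_energy:
  assumes sol: "closed_loop_on S x k \<theta>h y z \<delta>" and t: "t \<in> S"
  shows "((\<lambda>s. seeking_energy \<delta>s (y s) (z s) (\<delta> s)) has_real_derivative
      seeking_rate \<delta>s (y t) (z t)) (at t within S)"
proof -
  note der = closed_loop_onD[OF sol t]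
  let ?e = "consensus_error A (y t) (z t)"
  let ?g = "\<lambda>i. marginal_cost i (z t $ i)"
  define v' where "v' j = (\<chi> i. - (\<delta> t $ i $ j) * ?e i j + ?g j)" for j
  have gap: "((\<lambda>s. estimate_gap (y s) (z s) j $ i) has_real_derivative v' j $ i) (at t within S)" for i j
    unfolding estimate_gap_def v'_def vec_lambda_beta
    using DERIV_diff[OF der(5)[of i j] der(4)[of j]] by simp
  have 1: "((\<lambda>s. \<Sum>i\<in>UNIV. (y s $ i - equilibrium $ i)\<^sup>2) has_real_derivative
      (\<Sum>i\<in>UNIV. 2 * - ((y t $ i - equilibrium $ i) * ?g i))) (at t within S)"
    by (intro DERIV_sum) (auto intro!: derivative_eq_intros der(4))
  have 2: "((\<lambda>s. \<Sum>j\<in>UNIV. estimate_gap (y s) (z s) j \<bullet> pinned_laplacian A j (estimate_gap (y s) (z s) j))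
      has_real_derivative (\<Sum>j\<in>UNIV. 2 * (\<Sum>i\<in>UNIV. (- (\<delta> t $ i $ j) * ?e i j + ?g j) * ?e i j)))
      (at t within S)"
  proof (intro DERIV_sum)
    fix j
    have "v' j \<bullet> pinned_laplacian A j (estimate_gap (y t) (z t) j)
        = (\<Sum>i\<in>UNIV. (- (\<delta> t $ i $ j) * ?e i j + ?g j) * ?e i j)"
      by (simp add: inner_vec_def v'_def consensus_error_eq)
    with has_real_derivative_pinned_form[where A=A and j=j and v'="v' j"
        and v="\<lambda>s. estimate_gap (y s) (z s) j", OF adjacency_sym gap]
    show "((\<lambda>s. estimate_gap (y s) (z s) j \<bullet> pinned_laplacian A j (estimate_gap (y s) (z s) j))
        has_real_derivative 2 * (\<Sum>i\<in>UNIV. (- (\<delta> t $ i $ j) * ?e i j + ?g j) * ?e i j)) (at t within S)"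
      by simp
  qed
  have 3: "((\<lambda>s. \<Sum>j\<in>UNIV. \<Sum>i\<in>UNIV. (\<delta> s $ i $ j - \<delta>s)\<^sup>2) has_real_derivative
      (\<Sum>j\<in>UNIV. \<Sum>i\<in>UNIV. 2 * ((\<delta> t $ i $ j - \<delta>s) * (?e i j)\<^sup>2))) (at t within S)"
    by (intro DERIV_sum) (auto intro!: derivative_eq_intros der(6))
  have *: "(\<Sum>i\<in>UNIV. 2 * - ((y t $ i - equilibrium $ i) * ?g i)) / 2
      + (\<Sum>j\<in>UNIV. 2 * (\<Sum>i\<in>UNIV. (- (\<delta> t $ i $ j) * ?e i j + ?g j) * ?e i j)) / 2
      + (\<Sum>j\<in>UNIV. \<Sum>i\<in>UNIV. 2 * ((\<delta> t $ i $ j - \<delta>s) * (?e i j)\<^sup>2)) / 2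
      = seeking_rate \<delta>s (y t) (z t)"
    unfolding seeking_rate_def sum_distrib_left[symmetric]
    by (simp add: sum.distrib[symmetric] algebra_simps power2_eq_square)
  show ?thesis
    unfolding seeking_energy_def *[symmetric]
    by (intro DERIV_add DERIV_cdivide 1 2 3)
qed

text \<open>The constant \<open>\<delta>s\<close> is a virtual gain large enough for the consensus protocol to dominate the drift of \<open>y\<close>;
  \<open>\<kappa>\<close> is the weight with which the seeking energy has to enter the energy of a tracking
  player.\<close>

definition dominating_gains :: "real \<Rightarrow> real \<Rightarrow> bool" where
  "dominating_gains \<delta>s \<kappa> \<longleftrightarrow> \<kappa> \<ge> 0 \<and>
     (\<forall>y z. seeking_rate \<delta>s y z \<le> - dissipation y z) \<and>
     (\<forall>y z i. (marginal_cost i (z $ i))\<^sup>2 \<le> \<kappa> * dissipation y z)"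

text \<open>Write \<open>\<epsilon>\<close> for the norm of all consensus errors and \<open>\<eta>\<close> for the distance of \<open>y\<close> from the equilibrium.
  Coercivity of the pinned Laplacians bounds the distance of each estimate from \<open>y\<close> by \<open>c * \<epsilon>\<close>, and the
  Lipschitz condition turns this into bounds for the marginal costs. The rate is then at
  most \<open>- m * \<eta>\<^sup>2 + C1 * \<eta> * \<epsilon> + (C2 - \<delta>s) * \<epsilon>\<^sup>2\<close>, and half of the first term
  together with a large \<open>\<delta>s\<close> absorbs the mixed term.\<close>

lemma dominating_gains_exist: "\<exists>\<delta>s \<kappa>. dominating_gains \<delta>s \<kappa>"
proof -
  obtain \<mu> where \<mu>: "\<mu> > 0" "\<And>j v. \<mu> * norm v \<le> norm (pinned_laplacian A j v)"
    using pinned_laplacian_coercive by metis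
  define n where "n = real CARD('n)"
  define \<Lambda> where "\<Lambda> = (\<Sum>k\<in>UNIV. l k)"
  define c where "c = n / \<mu>"
  have n: "n > 0" by (simp add: n_def)
  have \<Lambda>: "\<Lambda> \<ge> 0" unfolding \<Lambda>_def by (intro sum_nonneg) (simp add: l_nonneg)
  have c: "c > 0" using n \<mu> by (simp add: c_def)
  define C1 where "C1 = n * \<Lambda> * c + n\<^sup>2 * \<Lambda>"
  define C2 where "C2 = n\<^sup>2 * \<Lambda> * c"
  define \<delta>s where "\<delta>s = C2 + 1 + C1\<^sup>2 / (2 * m)"
  define \<kappa> where "\<kappa> = 2 * \<Lambda>\<^sup>2 * c\<^sup>2 + 4 * \<Lambda>\<^sup>2 / m"
  have stat: "marginal_cost i equilibrium = 0" for i
    using equilibrium_stationary by (simp add: pseudo_gradient_def vec_eq_iff)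
  {
    fix y :: "real ^ 'n" and z :: "real ^ 'n ^ 'n"
    let ?e = "consensus_error A y z"
    let ?g = "\<lambda>i. marginal_cost i (z $ i)"
    define E2 where "E2 = (\<Sum>j\<in>UNIV. \<Sum>i\<in>UNIV. (?e i j)\<^sup>2)"
    define \<epsilon> where "\<epsilon> = sqrt E2"
    define \<eta> where "\<eta> = norm (y - equilibrium)"
    have E2: "E2 \<ge> 0" unfolding E2_def by (intro sum_nonneg) auto
    have \<epsilon>: "\<epsilon> \<ge> 0" "\<epsilon>\<^sup>2 = E2" using E2 by (auto simp: \<epsilon>_def)
    have \<eta>: "\<eta> \<ge> 0" by (simp add: \<eta>_def)
    have col: "norm (pinned_laplacian A j (estimate_gap y z j)) \<le> \<epsilon>" for j
    proof (rule power2_le_imp_le)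
      have "(norm (pinned_laplacian A j (estimate_gap y z j)))\<^sup>2 = (\<Sum>i\<in>UNIV. (?e i j)\<^sup>2)"
        unfolding power2_norm_eq_inner inner_vec_def by (simp add: consensus_error_eq power2_eq_square)
      also have "\<dots> \<le> E2"
        unfolding E2_def using member_le_sum[of j UNIV "\<lambda>j. \<Sum>i\<in>UNIV. (?e i j)\<^sup>2"]
        by (simp add: sum_nonneg)
      finally show "(norm (pinned_laplacian A j (estimate_gap y z j)))\<^sup>2 \<le> \<epsilon>\<^sup>2" by (simp add: \<epsilon>)
    qed (rule \<epsilon>)
    have ent: "\<bar>?e i j\<bar> \<le> \<epsilon>" for i j
      using order_trans[OF component_le_norm_cart col[of j]] by (simp add: consensus_error_eq)
    have "\<bar>z $ i $ j - y $ j\<bar> \<le> \<epsilon> / \<mu>" for i j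
    proof -
      have "\<bar>z $ i $ j - y $ j\<bar> \<le> norm (estimate_gap y z j)"
        using component_le_norm_cart[of "estimate_gap y z j" i] by (simp add: estimate_gap_def)
      also have "\<dots> \<le> \<epsilon> / \<mu>"
        using order_trans[OF \<mu>(2) col[of j]] \<mu>(1) by (simp add: field_simps)
      finally show ?thesis .
    qed
    then have row: "norm (z $ i - y) \<le> c * \<epsilon>" for i
      using order_trans[OF norm_vec_le_sum[of "z $ i - y"] sum_bounded_above[of UNIV _ "\<epsilon> / \<mu>"]]
      by (simp add: c_def n_def)
    have g: "\<bar>?g i\<bar> \<le> \<Lambda> * (c * \<epsilon> + \<eta>)" for i
    proof -
      have "\<bar>?g i\<bar> \<le> \<Lambda> * norm (z $ i - equilibrium)"
        using marginal_cost_lipschitz[of i "z $ i" equilibrium] by (simp add: stat \<Lambda>_def)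
      also have "\<dots> \<le> \<Lambda> * (c * \<epsilon> + \<eta>)"
        using norm_triangle_ineq[of "z $ i - y" "y - equilibrium"] row[of i] \<Lambda>
        by (intro mult_left_mono) (auto simp: \<eta>_def)
      finally show ?thesis .
    qed
    have "(\<Sum>i\<in>UNIV. - ((y $ i - equilibrium $ i) * ?g i)) =
        - ((y - equilibrium) \<bullet> (pseudo_gradient f y - pseudo_gradient f equilibrium))
        + (\<Sum>i\<in>UNIV. (y $ i - equilibrium $ i) * (marginal_cost i y - ?g i))"
      by (simp add: inner_vec_def pseudo_gradient_def stat sum_negf[symmetric]
          sum.distrib[symmetric] algebra_simps)
    also have "(\<Sum>i\<in>UNIV. (y $ i - equilibrium $ i) * (marginal_cost i y - ?g i))
        \<le> of_nat (card (UNIV :: 'n set)) * (\<eta> * (\<Lambda> * (c * \<epsilon>)))"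
    proof (rule sum_bounded_above)
      fix i
      have "\<bar>y $ i - equilibrium $ i\<bar> \<le> \<eta>"
        using component_le_norm_cart[of "y - equilibrium" i] by (simp add: \<eta>_def)
      moreover have "\<bar>marginal_cost i y - ?g i\<bar> \<le> \<Lambda> * (c * \<epsilon>)"
        using order_trans[OF marginal_cost_lipschitz[of i y "z $ i"], of "\<Lambda> * (c * \<epsilon>)"] row[of i] \<Lambda>
        by (simp add: \<Lambda>_def[symmetric] norm_minus_commute mult_left_mono)
      ultimately have "\<bar>(y $ i - equilibrium $ i) * (marginal_cost i y - ?g i)\<bar> \<le> \<eta> * (\<Lambda> * (c * \<epsilon>))"
        unfolding abs_mult using \<eta> by (intro mult_mono) auto
      then show "(y $ i - equilibrium $ i) * (marginal_cost i y - ?g i) \<le> \<eta> * (\<Lambda> * (c * \<epsilon>))" by simp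
    qed
    finally have r1: "(\<Sum>i\<in>UNIV. - ((y $ i - equilibrium $ i) * ?g i))
        \<le> - m * \<eta>\<^sup>2 + n * (\<eta> * (\<Lambda> * (c * \<epsilon>)))"
      using strongly_monotone[of y equilibrium] by (simp add: n_def \<eta>_def)
    have "(\<Sum>j\<in>UNIV. \<Sum>i\<in>UNIV. ?e i j * ?g j)
        \<le> of_nat (card (UNIV :: 'n set)) * (of_nat (card (UNIV :: 'n set)) * (\<epsilon> * (\<Lambda> * (c * \<epsilon> + \<eta>))))"
    proof (intro sum_bounded_above)
      fix i j
      have "\<bar>?e i j * ?g j\<bar> \<le> \<epsilon> * (\<Lambda> * (c * \<epsilon> + \<eta>))"
        unfolding abs_mult using ent[of i j] g[of j] \<epsilon> by (intro mult_mono) auto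
      then show "?e i j * ?g j \<le> \<epsilon> * (\<Lambda> * (c * \<epsilon> + \<eta>))" by simp
    qed
    then have r2: "(\<Sum>j\<in>UNIV. \<Sum>i\<in>UNIV. ?e i j * ?g j) \<le> n\<^sup>2 * (\<epsilon> * (\<Lambda> * (c * \<epsilon> + \<eta>)))"
      by (simp add: n_def power2_eq_square)
    have young: "C1 * \<eta> * \<epsilon> \<le> m / 2 * \<eta>\<^sup>2 + C1\<^sup>2 / (2 * m) * \<epsilon>\<^sup>2"
    proof -
      have "0 \<le> (m * \<eta> - C1 * \<epsilon>)\<^sup>2" by simp
      then show ?thesis using m_pos by (simp add: field_simps power2_eq_square)
    qed
    have "seeking_rate \<delta>s y z = (\<Sum>i\<in>UNIV. - ((y $ i - equilibrium $ i) * ?g i))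
        + (\<Sum>j\<in>UNIV. \<Sum>i\<in>UNIV. ?e i j * ?g j) - \<delta>s * \<epsilon>\<^sup>2"
      by (simp add: seeking_rate_def \<epsilon>(2) E2_def sum_subtractf sum_distrib_left)
    also have "\<dots> \<le> - m * \<eta>\<^sup>2 + n * (\<eta> * (\<Lambda> * (c * \<epsilon>))) + n\<^sup>2 * (\<epsilon> * (\<Lambda> * (c * \<epsilon> + \<eta>))) - \<delta>s * \<epsilon>\<^sup>2"
      using r1 r2 by simp
    also have "\<dots> = - m * \<eta>\<^sup>2 + C1 * \<eta> * \<epsilon> + C2 * \<epsilon>\<^sup>2 - \<delta>s * \<epsilon>\<^sup>2"
      by (simp add: C1_def C2_def algebra_simps power2_eq_square)
    also have "\<dots> \<le> - m * \<eta>\<^sup>2 + (m / 2 * \<eta>\<^sup>2 + C1\<^sup>2 / (2 * m) * \<epsilon>\<^sup>2) + C2 * \<epsilon>\<^sup>2 - \<delta>s * \<epsilon>\<^sup>2"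
      using young by simp
    also have "\<dots> = - (m / 2 * \<eta>\<^sup>2 + \<epsilon>\<^sup>2)"
      by (simp add: \<delta>s_def algebra_simps)
    also have D: "m / 2 * \<eta>\<^sup>2 + \<epsilon>\<^sup>2 = dissipation y z"
      by (simp add: dissipation_def \<epsilon> \<eta>_def E2_def)
    finally have rate: "seeking_rate \<delta>s y z \<le> - dissipation y z" .
    have "(?g i)\<^sup>2 \<le> \<kappa> * dissipation y z" for i
    proof -
      have "(?g i)\<^sup>2 \<le> (\<Lambda> * (c * \<epsilon> + \<eta>))\<^sup>2"
        using power_mono[OF g[of i], of 2] by simp
      also have "\<dots> = \<Lambda>\<^sup>2 * (c * \<epsilon> + \<eta>)\<^sup>2" by (simp add: power_mult_distrib)
      also have "\<dots> \<le> \<Lambda>\<^sup>2 * (2 * (c\<^sup>2 * \<epsilon>\<^sup>2 + \<eta>\<^sup>2))"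
      proof (rule mult_left_mono)
        have "0 \<le> (c * \<epsilon> - \<eta>)\<^sup>2" by simp
        then show "(c * \<epsilon> + \<eta>)\<^sup>2 \<le> 2 * (c\<^sup>2 * \<epsilon>\<^sup>2 + \<eta>\<^sup>2)"
          by (simp add: power2_eq_square algebra_simps)
      qed simp
      also have "\<dots> \<le> \<Lambda>\<^sup>2 * (2 * (c\<^sup>2 * \<epsilon>\<^sup>2 + \<eta>\<^sup>2)) + (\<Lambda>\<^sup>2 * c\<^sup>2 * m * \<eta>\<^sup>2 + 4 * \<Lambda>\<^sup>2 / m * \<epsilon>\<^sup>2)"
        using m_pos by simp
      also have "\<dots> = \<kappa> * (m / 2 * \<eta>\<^sup>2 + \<epsilon>\<^sup>2)"
        using m_pos by (simp add: \<kappa>_def field_simps)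
      finally show ?thesis unfolding D .
    qed
    note rate this
  }
  moreover have "\<kappa> \<ge> 0" using m_pos by (simp add: \<kappa>_def)
  ultimately have "dominating_gains \<delta>s \<kappa>" unfolding dominating_gains_def by blast
  then show ?thesis by blast
qed

lemma pinned_laplacian_nonneg: "v \<bullet> pinned_laplacian A j v \<ge> 0"
  using pinned_laplacian_pos[OF two_players adjacency undirected connected, of v j]
  by (cases "v = 0") auto

lemma seeking_energy_nonneg: "seeking_energy \<delta>s y z \<delta> \<ge> 0"
  unfolding seeking_energy_def
  by (intro add_nonneg_nonneg divide_nonneg_pos sum_nonneg pinned_laplacian_nonneg) auto

lemma seeking_state_bounded:
  obtains B where "\<And>y z \<delta> i j. seeking_energy \<delta>s y z \<delta> \<le> V \<Longrightarrow>
    \<bar>y $ i\<bar> \<le> B \<and> \<bar>z $ i $ j\<bar> \<le> B \<and> \<bar>\<delta> $ i $ j\<bar> \<le> B"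
proof -
  obtain c where c: "c > 0" "\<And>j v. c * (norm v)\<^sup>2 \<le> v \<bullet> pinned_laplacian A j v"
    using pinned_laplacian_coercive by metis
  define B1 where "B1 = (\<Sum>i\<in>UNIV. \<bar>equilibrium $ i\<bar>) + (2 * V + 1)"
  define B where "B = (B1 + (2 * V / c + 1)) + (\<bar>\<delta>s\<bar> + (2 * V + 1))"
  have "\<bar>y $ i\<bar> \<le> B \<and> \<bar>z $ i $ j\<bar> \<le> B \<and> \<bar>\<delta> $ i $ j\<bar> \<le> B"
    if le: "seeking_energy \<delta>s y z \<delta> \<le> V" for y z \<delta> i j
  proof -
    let ?v = "estimate_gap y z"
    have V: "V \<ge> 0" using le seeking_energy_nonneg order_trans by blast
    have nn: "(\<Sum>i\<in>UNIV. (y $ i - equilibrium $ i)\<^sup>2) \<ge> 0"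
      "(\<Sum>j\<in>UNIV. ?v j \<bullet> pinned_laplacian A j (?v j)) \<ge> 0"
      "(\<Sum>j\<in>UNIV. \<Sum>i\<in>UNIV. (\<delta> $ i $ j - \<delta>s)\<^sup>2) \<ge> 0"
      by (intro sum_nonneg pinned_laplacian_nonneg zero_le_power2)+
    have y: "\<bar>y $ i\<bar> \<le> B1" for i
    proof -
      have "(y $ i - equilibrium $ i)\<^sup>2 \<le> (\<Sum>i\<in>UNIV. (y $ i - equilibrium $ i)\<^sup>2)"
        by (intro member_le_sum) auto
      also have "\<dots> \<le> 2 * V" using le nn by (simp add: seeking_energy_def)
      finally have "\<bar>y $ i - equilibrium $ i\<bar> \<le> 2 * V + 1" by (rule abs_le_of_square_le)
      moreover have "\<bar>equilibrium $ i\<bar> \<le> (\<Sum>i\<in>UNIV. \<bar>equilibrium $ i\<bar>)"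
        by (intro member_le_sum) auto
      ultimately show ?thesis by (simp add: B1_def)
    qed
    have "(\<delta> $ i $ j - \<delta>s)\<^sup>2 \<le> (\<Sum>i\<in>UNIV. (\<delta> $ i $ j - \<delta>s)\<^sup>2)"
      by (intro member_le_sum) auto
    also have "\<dots> \<le> (\<Sum>j\<in>UNIV. \<Sum>i\<in>UNIV. (\<delta> $ i $ j - \<delta>s)\<^sup>2)"
      by (intro member_le_sum[where f="\<lambda>j. \<Sum>i\<in>UNIV. (\<delta> $ i $ j - \<delta>s)\<^sup>2"] sum_nonneg) auto
    also have "\<dots> \<le> 2 * V" using le nn by (simp add: seeking_energy_def)
    finally have \<delta>: "\<bar>\<delta> $ i $ j - \<delta>s\<bar> \<le> 2 * V + 1" by (rule abs_le_of_square_le)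
    have "c * (z $ i $ j - y $ j)\<^sup>2 \<le> c * (norm (?v j))\<^sup>2"
      using component_le_norm_cart[of "?v j" i] c(1)
      by (intro mult_left_mono) (auto simp: estimate_gap_def abs_le_square_iff[symmetric])
    also have "\<dots> \<le> ?v j \<bullet> pinned_laplacian A j (?v j)" by (rule c)
    also have "\<dots> \<le> (\<Sum>j\<in>UNIV. ?v j \<bullet> pinned_laplacian A j (?v j))"
      by (intro member_le_sum[where f="\<lambda>j. ?v j \<bullet> pinned_laplacian A j (?v j)"]
          pinned_laplacian_nonneg) auto
    also have "\<dots> \<le> 2 * V" using le nn by (simp add: seeking_energy_def)
    finally have "(z $ i $ j - y $ j)\<^sup>2 \<le> 2 * V / c" using c(1) by (simp add: field_simps)
    then have z: "\<bar>z $ i $ j - y $ j\<bar> \<le> 2 * V / c + 1" by (rule abs_le_of_square_le)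
    have pos: "2 * V / c + 1 \<ge> 0" "\<bar>\<delta>s\<bar> + (2 * V + 1) \<ge> 0" "B1 \<ge> 0"
      using V c(1) y[of i] by (auto simp: add_nonneg_nonneg)
    show ?thesis using y[of i] y[of j] z \<delta> pos unfolding B_def by linarith
  qed
  then show ?thesis using that by blast
qed

section \<open>The energy of the tracking dynamics\<close>

text \<open>The primitive has slope \<open>b i * nussbaum k + 1\<close>. The summand \<open>b i * nussbaum k\<close> compensates the
  control input of unknown sign, and the summand 1 produces the damping \<open>- (x - y)\<^sup>2\<close>.\<close>

definition tracking_energy :: "'n \<Rightarrow> real \<Rightarrow> real \<Rightarrow> real \<Rightarrow> real \<Rightarrow> real" where
  "tracking_energy i x k \<theta>h y =
     (x - y)\<^sup>2 / 2 + (\<theta>h - \<theta> i)\<^sup>2 / 2 - nussbaum_primitive (b i) k"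

lemma has_real_derivative_tracking_energy:
  assumes sol: "closed_loop_on S x k \<theta>h y z \<delta>" and t: "t \<in> S"
  shows "((\<lambda>s. tracking_energy i (x s $ i) (k s $ i) (\<theta>h s $ i) (y s $ i)) has_real_derivative
      (x t $ i - y t $ i) * marginal_cost i (z t $ i) - (x t $ i - y t $ i)\<^sup>2) (at t within S)"
proof -
  note der = closed_loop_onD[OF sol t, of i]
  have F: "((\<lambda>s. nussbaum_primitive (b i) (k s $ i)) has_real_derivative
      (b i * nussbaum (k t $ i) + 1) *
      ((x t $ i - y t $ i) * (x t $ i - y t $ i + \<phi> i (x t $ i) * \<theta>h t $ i))) (at t within S)"
    by (rule DERIV_chain2[OF has_real_derivative_nussbaum_primitive der(2)])
  show ?thesis
    unfolding tracking_energy_def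
    by (auto intro!: derivative_eq_intros F der)
       (simp add: control_input_def field_simps power2_eq_square)
qed

lemma continuous_phi: "continuous_on UNIV (\<phi> i)"
  using phi_C1[of i]
  by (auto simp: continuously_differentiable_def intro!: continuous_at_imp_continuous_on
      intro: has_derivative_continuous)

context
  fixes \<delta>s \<kappa> :: real
  assumes gains: "dominating_gains \<delta>s \<kappa>"
begin

lemma \<kappa>_nonneg: "\<kappa> \<ge> 0"
  and rate_le: "seeking_rate \<delta>s y z \<le> - dissipation y z"
  and marginal_cost_le: "(marginal_cost i (z $ i))\<^sup>2 \<le> \<kappa> * dissipation y z"
  using gains unfolding dominating_gains_def by blast+

lemma dissipation_ge: "dissipation y z \<ge> m / 2 * (y $ i - equilibrium $ i)\<^sup>2"
proof -
  have "(y $ i - equilibrium $ i)\<^sup>2 \<le> (norm (y - equilibrium))\<^sup>2"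
    using component_le_norm_cart[of "y - equilibrium" i] by (simp add: abs_le_square_iff[symmetric])
  then have "m / 2 * (y $ i - equilibrium $ i)\<^sup>2 \<le> m / 2 * (norm (y - equilibrium))\<^sup>2"
    using m_pos by (intro mult_left_mono) auto
  also have "\<dots> \<le> dissipation y z"
    unfolding dissipation_def by (simp add: sum_nonneg)
  finally show ?thesis .
qed

lemma seeking_rate_le: "seeking_rate \<delta>s y z \<le> - (m / 2) * (y $ i - equilibrium $ i)\<^sup>2"
  using rate_le[of y z] dissipation_ge[where y=y and i=i and z=z] by simp

definition total_energy :: "'n \<Rightarrow> real \<Rightarrow> real \<Rightarrow> real \<Rightarrow> real ^ 'n \<Rightarrow> real ^ 'n ^ 'n \<Rightarrow> real ^ 'n ^ 'n \<Rightarrow> real"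
  where "total_energy i x k \<theta>h y z \<delta> =
    tracking_energy i x k \<theta>h (y $ i) + \<kappa> / 2 * seeking_energy \<delta>s y z \<delta>"

lemma has_real_derivative_total_energy:
  assumes "closed_loop_on S x k \<theta>h y z \<delta>" and "t \<in> S"
  shows "((\<lambda>s. total_energy i (x s $ i) (k s $ i) (\<theta>h s $ i) (y s) (z s) (\<delta> s)) has_real_derivative
      ((x t $ i - y t $ i) * marginal_cost i (z t $ i) - (x t $ i - y t $ i)\<^sup>2)
      + \<kappa> / 2 * seeking_rate \<delta>s (y t) (z t)) (at t within S)"
  unfolding total_energy_def
  by (intro DERIV_add DERIV_cmult has_real_derivative_tracking_energy[OF assms]
      has_real_derivative_seeking_energy[OF assms])

lemma total_rate_le:
  "s * marginal_cost i (z $ i) - s\<^sup>2 + \<kappa> / 2 * seeking_rate \<delta>s y z \<le> - (1/2) * s\<^sup>2"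
proof -
  let ?g = "marginal_cost i (z $ i)"
  have "s * ?g \<le> s\<^sup>2 / 2 + ?g\<^sup>2 / 2"
    using zero_le_power2[of "s - ?g"] by (simp add: power2_eq_square algebra_simps)
  moreover have "\<kappa> / 2 * seeking_rate \<delta>s y z \<le> \<kappa> / 2 * - dissipation y z"
    using \<kappa>_nonneg by (intro mult_left_mono rate_le) auto
  ultimately show ?thesis using marginal_cost_le[where z=z and i=i and y=y] by simp
qed

lemma total_energy_ge: "total_energy i x k \<theta>h y z \<delta> \<ge>
    (x - y $ i)\<^sup>2 / 2 + (\<theta>h - \<theta> i)\<^sup>2 / 2 - nussbaum_primitive (b i) k"
  using seeking_energy_nonneg[of \<delta>s y z \<delta>] \<kappa>_nonneg
  by (simp add: total_energy_def tracking_energy_def)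

lemma seeking_energy_le_initial:
  assumes "closed_loop_on S x k \<theta>h y z \<delta>" "0 \<le> t" "{0..t} \<subseteq> S"
  shows "seeking_energy \<delta>s (y t) (z t) (\<delta> t) \<le> seeking_energy \<delta>s (y 0) (z 0) (\<delta> 0)"
proof (rule deriv_within_nonpos_imp_antimono[OF assms(3,2)
      has_real_derivative_seeking_energy[OF assms(1)]])
  show "seeking_rate \<delta>s (y t) (z t) \<le> 0" for t
    using rate_le[of "y t" "z t"] dissipation_nonneg[of "y t" "z t"] by simp
qed

lemma total_energy_le_initial:
  assumes "closed_loop_on S x k \<theta>h y z \<delta>" "0 \<le> t" "{0..t} \<subseteq> S"
  shows "total_energy i (x t $ i) (k t $ i) (\<theta>h t $ i) (y t) (z t) (\<delta> t)
    \<le> total_energy i (x 0 $ i) (k 0 $ i) (\<theta>h 0 $ i) (y 0) (z 0) (\<delta> 0)"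
proof (rule deriv_within_nonpos_imp_antimono[OF assms(3,2)
      has_real_derivative_total_energy[OF assms(1)]])
  show "((x t $ i - y t $ i) * marginal_cost i (z t $ i) - (x t $ i - y t $ i)\<^sup>2)
      + \<kappa> / 2 * seeking_rate \<delta>s (y t) (z t) \<le> 0" for t
    using total_rate_le[where s="x t $ i - y t $ i" and i=i and z="z t" and y="y t"] zero_le_power2[of "x t $ i - y t $ i"]
    by linarith
qed

text \<open>The seeking energy bounds \<open>y\<close>, \<open>z\<close> and \<open>\<delta>\<close>. The total energy is not yet a bound for a tracking player, because the
  primitive enters with a minus sign; but it keeps the primitive from below, which confines
  \<open>k\<close> and thereby bounds the primitive from above, and then the squares are bounded as well. It is essential
  for existence that the bound is chosen before the time domain.\<close>

lemma a_priori_bound: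
  fixes x0 k0 \<theta>h0 y0 :: "real ^ 'n" and z0 \<delta>0 :: "real ^ 'n ^ 'n"
  shows "\<exists>B. \<forall>S x k \<theta>h y z \<delta> t. closed_loop_on S x k \<theta>h y z \<delta> \<longrightarrow>
    x 0 = x0 \<and> k 0 = k0 \<and> \<theta>h 0 = \<theta>h0 \<and> y 0 = y0 \<and> z 0 = z0 \<and> \<delta> 0 = \<delta>0 \<longrightarrow>
    0 \<le> t \<longrightarrow> {0..t} \<subseteq> S \<longrightarrow>
    (\<forall>i j. \<bar>x t $ i\<bar> \<le> B \<and> \<bar>k t $ i\<bar> \<le> B \<and> \<bar>\<theta>h t $ i\<bar> \<le> B \<and> \<bar>y t $ i\<bar> \<le> B \<and>
      \<bar>z t $ i $ j\<bar> \<le> B \<and> \<bar>\<delta> t $ i $ j\<bar> \<le> B)"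
proof -
  define starts where "starts x k \<theta>h y z \<delta> \<longleftrightarrow>
    x (0::real) = x0 \<and> k (0::real) = k0 \<and> \<theta>h (0::real) = \<theta>h0 \<and> y (0::real) = y0 \<and>
    z (0::real) = z0 \<and> \<delta> (0::real) = \<delta>0" for x k \<theta>h y z \<delta>
  obtain B1 where B1: "\<And>y z \<delta> i j. seeking_energy \<delta>s y z \<delta> \<le> seeking_energy \<delta>s y0 z0 \<delta>0 \<Longrightarrow>
      \<bar>y $ i\<bar> \<le> B1 \<and> \<bar>z $ i $ j\<bar> \<le> B1 \<and> \<bar>\<delta> $ i $ j\<bar> \<le> B1"
    using seeking_state_bounded[of \<delta>s "seeking_energy \<delta>s y0 z0 \<delta>0"] by blast
  have seek: "\<bar>y t $ i\<bar> \<le> B1 \<and> \<bar>z t $ i $ j\<bar> \<le> B1 \<and> \<bar>\<delta> t $ i $ j\<bar> \<le> B1"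
    if "closed_loop_on S x k \<theta>h y z \<delta>" "starts x k \<theta>h y z \<delta>" "0 \<le> t" "{0..t} \<subseteq> S"
    for S x k \<theta>h y z \<delta> t i j
    using seeking_energy_le_initial[OF that(1,3,4)] that(2) by (intro B1) (auto simp: starts_def)
  have "\<exists>B. \<forall>S x k \<theta>h y z \<delta> t. closed_loop_on S x k \<theta>h y z \<delta> \<longrightarrow> starts x k \<theta>h y z \<delta> \<longrightarrow>
      0 \<le> t \<longrightarrow> {0..t} \<subseteq> S \<longrightarrow> \<bar>x t $ i\<bar> \<le> B \<and> \<bar>k t $ i\<bar> \<le> B \<and> \<bar>\<theta>h t $ i\<bar> \<le> B" for i
  proof -
    define U where "U = total_energy i (x0 $ i) (k0 $ i) (\<theta>h0 $ i) y0 z0 \<delta>0"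
    from nussbaum_gain_bounded[OF b_nonzero[of i], of "k0 $ i" U]
    obtain K where K: "\<forall>(T::real) k. continuous_on {0..T} k \<longrightarrow> k 0 = k0 $ i \<longrightarrow>
      (\<forall>s\<in>{0..T}. nussbaum_primitive (b i) (k s) \<ge> - U) \<longrightarrow> (\<forall>t\<in>{0..T}. \<bar>k t\<bar> \<le> K)" ..
    obtain C where C: "\<And>s. \<bar>s\<bar> \<le> K \<Longrightarrow> \<bar>nussbaum_primitive (b i) s\<bar> \<le> C"
      using continuous_on_bounded_image[OF continuous_nussbaum_primitive] by blast
    define B where "B = \<bar>K\<bar> + \<bar>B1\<bar> + \<bar>\<theta> i\<bar> + \<bar>2 * (U + C) + 1\<bar>"
    have "\<bar>x t $ i\<bar> \<le> B \<and> \<bar>k t $ i\<bar> \<le> B \<and> \<bar>\<theta>h t $ i\<bar> \<le> B"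
      if sol: "closed_loop_on S x k \<theta>h y z \<delta>" and st: "starts x k \<theta>h y z \<delta>"
        and t: "0 \<le> t" "{0..t} \<subseteq> S" for S x k \<theta>h y z \<delta> t
    proof -
      have ineq: "(x s $ i - y s $ i)\<^sup>2 / 2 + (\<theta>h s $ i - \<theta> i)\<^sup>2 / 2
          - nussbaum_primitive (b i) (k s $ i) \<le> U" if "s \<in> {0..t}" for s
        using total_energy_le_initial[OF sol, of s i] that t st
          total_energy_ge[where x="x s $ i" and y="y s" and \<theta>h="\<theta>h s $ i" and i=i
            and k="k s $ i" and z="z s" and \<delta>="\<delta> s"]
        by (force simp: U_def starts_def)
      have k: "\<bar>k t $ i\<bar> \<le> K"
      proof (rule K[rule_format, where T=t and t=t and k="\<lambda>s. k s $ i"])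
        show "continuous_on {0..t} (\<lambda>s. k s $ i)"
          using closed_loop_onD(2)[OF sol] t(2)
          by (intro DERIV_continuous_on[where D="\<lambda>t. (x t $ i - y t $ i) *
              (x t $ i - y t $ i + \<phi> i (x t $ i) * \<theta>h t $ i)"] DERIV_subset[OF _ t(2)]) auto
        show "k 0 $ i = k0 $ i" using st by (simp add: starts_def)
        show "nussbaum_primitive (b i) (k s $ i) \<ge> - U" if "s \<in> {0..t}" for s
          using ineq[OF that] zero_le_power2[of "x s $ i - y s $ i"]
            zero_le_power2[of "\<theta>h s $ i - \<theta> i"] by linarith
      qed (use t in auto)
      have le: "(x t $ i - y t $ i)\<^sup>2 / 2 + (\<theta>h t $ i - \<theta> i)\<^sup>2 / 2 \<le> U + C"
        using ineq[of t] C[OF k] t by auto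
      have sq: "(x t $ i - y t $ i)\<^sup>2 \<le> 2 * (U + C)" "(\<theta>h t $ i - \<theta> i)\<^sup>2 \<le> 2 * (U + C)"
      proof -
        have "p \<le> 2 * w" "q \<le> 2 * w" if "p / 2 + q / 2 \<le> w" "0 \<le> p" "0 \<le> q" for p q w :: real
          using that by linarith+
        from this[OF le] show "(x t $ i - y t $ i)\<^sup>2 \<le> 2 * (U + C)" "(\<theta>h t $ i - \<theta> i)\<^sup>2 \<le> 2 * (U + C)"
          by simp_all
      qed
      have "\<bar>y t $ i\<bar> \<le> B1" using seek[OF sol st t] by blast
      then show ?thesis
        using k abs_le_of_square_le[OF sq(1)] abs_le_of_square_le[OF sq(2)]
        unfolding B_def by linarith
    qed
    then show ?thesis by blast
  qed
  then have "\<forall>i. \<exists>B. \<forall>S x k \<theta>h y z \<delta> t. closed_loop_on S x k \<theta>h y z \<delta> \<longrightarrow> starts x k \<theta>h y z \<delta> \<longrightarrow>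
      0 \<le> t \<longrightarrow> {0..t} \<subseteq> S \<longrightarrow> \<bar>x t $ i\<bar> \<le> B \<and> \<bar>k t $ i\<bar> \<le> B \<and> \<bar>\<theta>h t $ i\<bar> \<le> B" ..
  from choice[OF this]
  obtain B2 where B2: "\<forall>i. \<forall>S x k \<theta>h y z \<delta> t. closed_loop_on S x k \<theta>h y z \<delta> \<longrightarrow>
      starts x k \<theta>h y z \<delta> \<longrightarrow> 0 \<le> t \<longrightarrow> {0..t} \<subseteq> S \<longrightarrow>
      \<bar>x t $ i\<bar> \<le> B2 i \<and> \<bar>k t $ i\<bar> \<le> B2 i \<and> \<bar>\<theta>h t $ i\<bar> \<le> B2 i" ..
  define B where "B = \<bar>B1\<bar> + (\<Sum>i\<in>UNIV. \<bar>B2 i\<bar>)"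
  have B2_le: "B2 i \<le> B" for i
    using member_le_sum[of i UNIV "\<lambda>i. \<bar>B2 i\<bar>"] by (simp add: B_def)
  have B1_le: "B1 \<le> B" by (simp add: B_def add_increasing2 sum_nonneg)
  show ?thesis
  proof (intro exI[of _ B] allI impI)
    fix S x k \<theta>h y z \<delta> t i j
    assume sol: "closed_loop_on S x k \<theta>h y z \<delta>"
      and "x 0 = x0 \<and> k 0 = k0 \<and> \<theta>h 0 = \<theta>h0 \<and> y 0 = y0 \<and> z 0 = z0 \<and> \<delta> 0 = \<delta>0"
      and t: "0 \<le> t" "{0..t} \<subseteq> S"
    then have st: "starts x k \<theta>h y z \<delta>" by (simp add: starts_def)
    from seek[OF sol st t, of i j] B2[rule_format, OF sol st t, of i] B1_le B2_le[of i]
    show "\<bar>x t $ i\<bar> \<le> B \<and> \<bar>k t $ i\<bar> \<le> B \<and> \<bar>\<theta>h t $ i\<bar> \<le> B \<and> \<bar>y t $ i\<bar> \<le> B \<and>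
      \<bar>z t $ i $ j\<bar> \<le> B \<and> \<bar>\<delta> t $ i $ j\<bar> \<le> B" by linarith
  qed
qed

end

section \<open>Existence of trajectories\<close>

definition closed_loop_field :: "'n closed_loop_state \<Rightarrow> 'n closed_loop_state" where
  "closed_loop_field u = (case u of (x, k, \<theta>h, y, z, \<delta>) \<Rightarrow>
     ((\<chi> i. b i * control_input (\<phi> i) (x $ i) (k $ i) (\<theta>h $ i) (y $ i) + \<phi> i (x $ i) * \<theta> i),
      (\<chi> i. (x $ i - y $ i) * (x $ i - y $ i + \<phi> i (x $ i) * \<theta>h $ i)),
      (\<chi> i. \<phi> i (x $ i) * (x $ i - y $ i)),
      (\<chi> i. - marginal_cost i (z $ i)),
      (\<chi> i j. - (\<delta> $ i $ j) * consensus_error A y z i j),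
      (\<chi> i j. (consensus_error A y z i j)\<^sup>2)))"

lemma lipschitz_on_balls_closed_loop_field: "lipschitz_on_balls closed_loop_field"
proof -
  note proj = bounded_linear_state_projections[THEN lipschitz_on_balls_linear]
  have phi: "lipschitz_on_balls (\<lambda>u::'n closed_loop_state. \<phi> i (fst u $ i))" for i
    by (rule lipschitz_on_balls_compose[OF lipschitz_on_balls_continuously_differentiable[OF phi_C1] proj(1)])
  have cost: "lipschitz_on_balls (\<lambda>u::'n closed_loop_state. marginal_cost i (fst (snd (snd (snd (snd u)))) $ i))" for i
    by (rule lipschitz_on_balls_compose[OF lipschitz_on_balls_of_lipschitz[OF cost_lipschitz] proj(5)])
  show ?thesis
    unfolding closed_loop_field_def case_prod_beta control_input_def nussbaum_def consensus_error_def
      power2_eq_square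
    by (intro lipschitz_on_balls_intros proj phi cost)
qed

lemma closed_loop_on_if_field:
  assumes u: "\<And>t. t \<in> S \<Longrightarrow> (u has_vector_derivative closed_loop_field (u t)) (at t within S)"
  shows "closed_loop_on S (\<lambda>t. fst (u t)) (\<lambda>t. fst (snd (u t))) (\<lambda>t. fst (snd (snd (u t))))
    (\<lambda>t. fst (snd (snd (snd (u t))))) (\<lambda>t. fst (snd (snd (snd (snd (u t))))))
    (\<lambda>t. snd (snd (snd (snd (snd (u t))))))"
proof -
  have der: "((\<lambda>s. p (u s)) has_real_derivative p (closed_loop_field (u t))) (at t within S)"
    if "bounded_linear p" "t \<in> S" for p :: "'n closed_loop_state \<Rightarrow> real" and t
    unfolding has_real_derivative_iff_has_vector_derivative
    by (rule bounded_linear.has_vector_derivative[OF that(1) u[OF that(2)]])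
  show ?thesis
    unfolding closed_loop_on_def
  proof (intro ballI allI conjI)
    fix t i j assume t: "t \<in> S"
    note d = der[OF _ t]
    show "((\<lambda>s. fst (u s) $ i) has_real_derivative b i * control_input (\<phi> i) (fst (u t) $ i)
        (fst (snd (u t)) $ i) (fst (snd (snd (u t))) $ i) (fst (snd (snd (snd (u t)))) $ i)
        + \<phi> i (fst (u t) $ i) * \<theta> i) (at t within S)"
      using d[OF bounded_linear_state_projections(1)[of i]]
      by (simp add: closed_loop_field_def case_prod_beta)
    show "((\<lambda>s. fst (snd (u s)) $ i) has_real_derivative
        (fst (u t) $ i - fst (snd (snd (snd (u t)))) $ i) * (fst (u t) $ i - fst (snd (snd (snd (u t)))) $ i
          + \<phi> i (fst (u t) $ i) * fst (snd (snd (u t))) $ i)) (at t within S)"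
      using d[OF bounded_linear_state_projections(2)[of i]]
      by (simp add: closed_loop_field_def case_prod_beta)
    show "((\<lambda>s. fst (snd (snd (u s))) $ i) has_real_derivative
        \<phi> i (fst (u t) $ i) * (fst (u t) $ i - fst (snd (snd (snd (u t)))) $ i)) (at t within S)"
      using d[OF bounded_linear_state_projections(3)[of i]]
      by (simp add: closed_loop_field_def case_prod_beta)
    show "((\<lambda>s. fst (snd (snd (snd (u s)))) $ i) has_real_derivative
        - marginal_cost i (fst (snd (snd (snd (snd (u t))))) $ i)) (at t within S)"
      using d[OF bounded_linear_state_projections(4)[of i]]
      by (simp add: closed_loop_field_def case_prod_beta)
    show "((\<lambda>s. fst (snd (snd (snd (snd (u s))))) $ i $ j) has_real_derivative
        - (snd (snd (snd (snd (snd (u t))))) $ i $ j) *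
          consensus_error A (fst (snd (snd (snd (u t))))) (fst (snd (snd (snd (snd (u t)))))) i j) (at t within S)"
      using d[OF bounded_linear_state_projections(6)[of i j]]
      by (simp add: closed_loop_field_def case_prod_beta)
    show "((\<lambda>s. snd (snd (snd (snd (snd (u s))))) $ i $ j) has_real_derivative
        (consensus_error A (fst (snd (snd (snd (u t))))) (fst (snd (snd (snd (snd (u t)))))) i j)\<^sup>2) (at t within S)"
      using d[OF bounded_linear_state_projections(7)[of i j]]
      by (simp add: closed_loop_field_def case_prod_beta)
  qed
qed

text \<open>The bounds on the components give a ball that no solution on a compact interval leaves, so the
  truncation argument applies.\<close>

theorem closed_loop_exists:
  "\<exists>x k \<theta>h y z \<delta>. closed_loop_on {0..} x k \<theta>h y z \<delta> \<and>
    x 0 = x0 \<and> k 0 = k0 \<and> \<theta>h 0 = \<theta>h0 \<and> y 0 = y0 \<and> z 0 = z0 \<and> \<delta> 0 = \<delta>0"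
proof -
  obtain \<delta>s \<kappa> where gains: "dominating_gains \<delta>s \<kappa>"
    using dominating_gains_exist by blast
  from a_priori_bound[OF gains, of x0 k0 \<theta>h0 y0 z0 \<delta>0]
  obtain B where B: "\<forall>S x k \<theta>h y z \<delta> t. closed_loop_on S x k \<theta>h y z \<delta> \<longrightarrow>
    x 0 = x0 \<and> k 0 = k0 \<and> \<theta>h 0 = \<theta>h0 \<and> y 0 = y0 \<and> z 0 = z0 \<and> \<delta> 0 = \<delta>0 \<longrightarrow>
    0 \<le> t \<longrightarrow> {0..t} \<subseteq> S \<longrightarrow>
    (\<forall>i j. \<bar>x t $ i\<bar> \<le> B \<and> \<bar>k t $ i\<bar> \<le> B \<and> \<bar>\<theta>h t $ i\<bar> \<le> B \<and> \<bar>y t $ i\<bar> \<le> B \<and>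
      \<bar>z t $ i $ j\<bar> \<le> B \<and> \<bar>\<delta> t $ i $ j\<bar> \<le> B)" ..
  define n where "n = real CARD('n)"
  have ball: "norm u \<le> n * B + (n * B + (n * B + (n * B + (n * (n * B) + n * (n * B)))))"
    if "\<And>i j. \<bar>fst u $ i\<bar> \<le> B \<and> \<bar>fst (snd u) $ i\<bar> \<le> B \<and> \<bar>fst (snd (snd u)) $ i\<bar> \<le> B \<and>
      \<bar>fst (snd (snd (snd u))) $ i\<bar> \<le> B \<and> \<bar>fst (snd (snd (snd (snd u)))) $ i $ j\<bar> \<le> B \<and>
      \<bar>snd (snd (snd (snd (snd u)))) $ i $ j\<bar> \<le> B" for u :: "'n closed_loop_state"
  proof -
    have pair: "norm w \<le> p + q" if "norm (fst w) \<le> p" "norm (snd w) \<le> q"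
      for w :: "'a::real_normed_vector \<times> 'b::real_normed_vector" and p q
      using norm_Pair_le[of "fst w" "snd w"] that by simp
    show ?thesis
      unfolding n_def by (intro pair norm_vec_le_card) (use that in auto)
  qed
  obtain u where u0: "u 0 = (x0, k0, \<theta>h0, y0, z0, \<delta>0)"
    and u: "\<And>t. t \<ge> 0 \<Longrightarrow> (u has_vector_derivative closed_loop_field (u t)) (at t within {0..})"
  proof (rule global_solution_of_apriori_bound[where G=closed_loop_field and ?x0.0="(x0, k0, \<theta>h0, y0, z0, \<delta>0)"])
    show "\<exists>L. L-lipschitz_on (cball 0 R) closed_loop_field" for R
      using lipschitz_on_balls_closed_loop_field by (simp add: lipschitz_on_balls_def)
    fix T and u :: "real \<Rightarrow> 'n closed_loop_state"
    assume T: "T \<ge> 0" and u0: "u 0 = (x0, k0, \<theta>h0, y0, z0, \<delta>0)"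
      and u: "\<And>t. t \<in> {0..T} \<Longrightarrow> (u has_vector_derivative closed_loop_field (u t)) (at t within {0..T})"
    show "norm (u T) \<le> n * B + (n * B + (n * B + (n * B + (n * (n * B) + n * (n * B)))))"
      by (rule ball, rule B[rule_format, OF closed_loop_on_if_field[OF u]]) (use T u0 in auto)
  qed blast
  show ?thesis
    by (intro exI conjI, rule closed_loop_on_if_field[of "{0..}" u]) (use u u0 in auto)
qed

section \<open>Convergence\<close>

text \<open>The convergence of \<open>x\<close> splits into that of \<open>y - equilibrium\<close>, driven by the seeking energy, and
  that of \<open>x - y\<close>, driven by the total energy. The a priori bounds supply the bounded
  derivatives and the lower bound of the total energy.\<close>

theorem closed_loop_bounded_and_convergent:
  assumes sol: "closed_loop_on {0..} x k \<theta>h y z \<delta>"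
  shows "((\<lambda>t. norm (x t - equilibrium)) \<longlongrightarrow> 0) at_top"
    and "\<exists>B. \<forall>t\<ge>0. \<forall>i j. \<bar>k t $ i\<bar> \<le> B \<and> \<bar>\<theta>h t $ i\<bar> \<le> B \<and> \<bar>y t $ i\<bar> \<le> B \<and>
      \<bar>z t $ i $ j\<bar> \<le> B \<and> \<bar>\<delta> t $ i $ j\<bar> \<le> B"
proof -
  obtain \<delta>s \<kappa> where gains: "dominating_gains \<delta>s \<kappa>"
    using dominating_gains_exist by blast
  from a_priori_bound[OF gains, of "x 0" "k 0" "\<theta>h 0" "y 0" "z 0" "\<delta> 0"]
  obtain B where "\<forall>S x' k' \<theta>h' y' z' \<delta>' t. closed_loop_on S x' k' \<theta>h' y' z' \<delta>' \<longrightarrow>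
    x' 0 = x 0 \<and> k' 0 = k 0 \<and> \<theta>h' 0 = \<theta>h 0 \<and> y' 0 = y 0 \<and> z' 0 = z 0 \<and> \<delta>' 0 = \<delta> 0 \<longrightarrow>
    0 \<le> t \<longrightarrow> {0..t} \<subseteq> S \<longrightarrow>
    (\<forall>i j. \<bar>x' t $ i\<bar> \<le> B \<and> \<bar>k' t $ i\<bar> \<le> B \<and> \<bar>\<theta>h' t $ i\<bar> \<le> B \<and> \<bar>y' t $ i\<bar> \<le> B \<and>
      \<bar>z' t $ i $ j\<bar> \<le> B \<and> \<bar>\<delta>' t $ i $ j\<bar> \<le> B)" ..
  from this[rule_format, OF sol]
  have B: "\<bar>x t $ i\<bar> \<le> B" "\<bar>k t $ i\<bar> \<le> B" "\<bar>\<theta>h t $ i\<bar> \<le> B" "\<bar>y t $ i\<bar> \<le> B"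
      "\<bar>z t $ i $ j\<bar> \<le> B" "\<bar>\<delta> t $ i $ j\<bar> \<le> B" if "t \<ge> 0" for t i j
    using that by auto
  then show "\<exists>B. \<forall>t\<ge>0. \<forall>i j. \<bar>k t $ i\<bar> \<le> B \<and> \<bar>\<theta>h t $ i\<bar> \<le> B \<and> \<bar>y t $ i\<bar> \<le> B \<and>
      \<bar>z t $ i $ j\<bar> \<le> B \<and> \<bar>\<delta> t $ i $ j\<bar> \<le> B" by blast
  have B0: "B \<ge> 0" using B(1)[of 0] by (meson abs_ge_zero order_refl order_trans)
  define G where "G = (\<Sum>k\<in>UNIV. l k) * (real CARD('n) * (B + norm equilibrium))"
  have lsum: "(\<Sum>k\<in>UNIV. l k) \<ge> 0" by (intro sum_nonneg) (simp add: l_nonneg)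
  have G: "\<bar>marginal_cost i (z t $ i)\<bar> \<le> G" if t: "t \<ge> 0" for t i
  proof -
    have "marginal_cost i equilibrium = 0"
      using equilibrium_stationary by (simp add: pseudo_gradient_def vec_eq_iff)
    then have "\<bar>marginal_cost i (z t $ i)\<bar> \<le> (\<Sum>k\<in>UNIV. l k) * norm (z t $ i - equilibrium)"
      using marginal_cost_lipschitz[of i "z t $ i" equilibrium] by simp
    also have "\<dots> \<le> G"
      unfolding G_def
    proof (intro mult_left_mono norm_vec_le_card lsum)
      show "norm ((z t $ i - equilibrium) $ j) \<le> B + norm equilibrium" for j
        using B(5)[OF t, of i j] component_le_norm_cart[of equilibrium j] by simp
    qed
    finally show ?thesis .
  qed
  have y_lim: "((\<lambda>t. y t $ i - equilibrium $ i) \<longlongrightarrow> 0) at_top" for i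
  proof (rule barbalat[where V="\<lambda>t. seeking_energy \<delta>s (y t) (z t) (\<delta> t)"
        and V'="\<lambda>t. seeking_rate \<delta>s (y t) (z t)" and c="m / 2" and v=0
        and h'="\<lambda>t. - marginal_cost i (z t $ i)" and K=G])
    fix t :: real assume t: "t \<ge> 0"
    show "((\<lambda>t. seeking_energy \<delta>s (y t) (z t) (\<delta> t)) has_real_derivative seeking_rate \<delta>s (y t) (z t))
        (at t within {0..})"
      using t by (intro has_real_derivative_seeking_energy[OF sol]) simp
    show "seeking_rate \<delta>s (y t) (z t) \<le> - (m / 2) * (y t $ i - equilibrium $ i)\<^sup>2"
      by (rule seeking_rate_le[OF gains])
    show "((\<lambda>t. y t $ i - equilibrium $ i) has_real_derivative - marginal_cost i (z t $ i)) (at t within {0..})"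
      using DERIV_diff[OF closed_loop_onD(4)[OF sol, of t i] DERIV_const] t by simp
    show "\<bar>- marginal_cost i (z t $ i)\<bar> \<le> G" using G[OF t] by simp
  qed (use m_pos seeking_energy_nonneg in auto)
  have s_lim: "((\<lambda>t. x t $ i - y t $ i) \<longlongrightarrow> 0) at_top" for i
  proof -
    obtain P where P: "\<And>s. \<bar>s\<bar> \<le> B \<Longrightarrow> \<bar>\<phi> i s\<bar> \<le> P"
      using continuous_on_bounded_image[OF continuous_phi] by blast
    have P0: "P \<ge> 0" using P[of 0] B0 by simp
    obtain C where C: "\<And>s. \<bar>s\<bar> \<le> B \<Longrightarrow> \<bar>nussbaum_primitive (b i) s\<bar> \<le> C"
      using continuous_on_bounded_image[OF continuous_nussbaum_primitive] by blast
    define K where "K = \<bar>b i\<bar> * (B\<^sup>2 * (B + B + P * B)) + P * \<bar>\<theta> i\<bar> + G"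
    show ?thesis
    proof (rule barbalat[where V="\<lambda>t. total_energy \<delta>s \<kappa> i (x t $ i) (k t $ i) (\<theta>h t $ i) (y t) (z t) (\<delta> t)"
          and c="1/2" and v="- C" and K=K
          and V'="\<lambda>t. (x t $ i - y t $ i) * marginal_cost i (z t $ i) - (x t $ i - y t $ i)\<^sup>2
            + \<kappa> / 2 * seeking_rate \<delta>s (y t) (z t)"
          and h'="\<lambda>t. b i * control_input (\<phi> i) (x t $ i) (k t $ i) (\<theta>h t $ i) (y t $ i)
             + \<phi> i (x t $ i) * \<theta> i - - marginal_cost i (z t $ i)"])
      fix t :: real assume t: "t \<ge> 0"
      show "((\<lambda>t. total_energy \<delta>s \<kappa> i (x t $ i) (k t $ i) (\<theta>h t $ i) (y t) (z t) (\<delta> t)) has_real_derivative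
          (x t $ i - y t $ i) * marginal_cost i (z t $ i) - (x t $ i - y t $ i)\<^sup>2
            + \<kappa> / 2 * seeking_rate \<delta>s (y t) (z t)) (at t within {0..})"
        using t by (intro has_real_derivative_total_energy[OF gains sol]) simp
      show "(x t $ i - y t $ i) * marginal_cost i (z t $ i) - (x t $ i - y t $ i)\<^sup>2
            + \<kappa> / 2 * seeking_rate \<delta>s (y t) (z t) \<le> - (1/2) * (x t $ i - y t $ i)\<^sup>2"
        by (rule total_rate_le[OF gains])
      have "- C \<le> - nussbaum_primitive (b i) (k t $ i)"
        using C[OF B(2)[OF t, of i]] by simp
      then show "total_energy \<delta>s \<kappa> i (x t $ i) (k t $ i) (\<theta>h t $ i) (y t) (z t) (\<delta> t) \<ge> - C"
        using total_energy_ge[OF gains, of "x t $ i" "y t" i "\<theta>h t $ i" "k t $ i" "z t" "\<delta> t"]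
          zero_le_power2[of "x t $ i - y t $ i"] zero_le_power2[of "\<theta>h t $ i - \<theta> i"] by linarith
      show "((\<lambda>t. x t $ i - y t $ i) has_real_derivative
          b i * control_input (\<phi> i) (x t $ i) (k t $ i) (\<theta>h t $ i) (y t $ i)
             + \<phi> i (x t $ i) * \<theta> i - - marginal_cost i (z t $ i)) (at t within {0..})"
        using t by (intro DERIV_diff closed_loop_onD[OF sol]) auto
      have "\<bar>nussbaum (k t $ i)\<bar> \<le> B\<^sup>2 * 1"
        unfolding nussbaum_def abs_mult
        using B(2)[OF t, of i] B0 by (intro mult_mono) (auto simp: abs_le_square_iff[symmetric])
      moreover have "\<bar>x t $ i - y t $ i + \<phi> i (x t $ i) * \<theta>h t $ i\<bar> \<le> B + B + P * B"
      proof -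
        have "\<bar>\<phi> i (x t $ i) * \<theta>h t $ i\<bar> \<le> P * B"
          unfolding abs_mult using P[OF B(1)[OF t, of i]] B(3)[OF t, of i] P0 by (intro mult_mono) auto
        then show ?thesis using B(1)[OF t, of i] B(4)[OF t, of i] by linarith
      qed
      ultimately have "\<bar>b i * control_input (\<phi> i) (x t $ i) (k t $ i) (\<theta>h t $ i) (y t $ i)\<bar>
          \<le> \<bar>b i\<bar> * (B\<^sup>2 * (B + B + P * B))"
        unfolding control_input_def abs_mult by (intro mult_left_mono mult_mono) auto
      moreover have "\<bar>\<phi> i (x t $ i) * \<theta> i\<bar> \<le> P * \<bar>\<theta> i\<bar>"
        unfolding abs_mult using P[OF B(1)[OF t, of i]] by (intro mult_right_mono) auto
      ultimately show "\<bar>b i * control_input (\<phi> i) (x t $ i) (k t $ i) (\<theta>h t $ i) (y t $ i)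
             + \<phi> i (x t $ i) * \<theta> i - - marginal_cost i (z t $ i)\<bar> \<le> K"
        using G[OF t, of i] unfolding K_def by linarith
    qed simp
  qed
  have "((\<lambda>t. x t - equilibrium) \<longlongrightarrow> 0) at_top"
  proof (rule vec_tendstoI)
    show "((\<lambda>t. (x t - equilibrium) $ i) \<longlongrightarrow> 0 $ i) at_top" for i
      using tendsto_add[OF s_lim[of i] y_lim[of i]] by simp
  qed
  then show "((\<lambda>t. norm (x t - equilibrium)) \<longlongrightarrow> 0) at_top"
    by (rule tendsto_norm_zero)
qed

end

theorem theorem4:
  fixes f :: "'n::finite \<Rightarrow> real ^ 'n \<Rightarrow> real"
    and \<phi> :: "'n \<Rightarrow> real \<Rightarrow> real"
    and b \<theta> l :: "'n \<Rightarrow> real"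
    and m :: real
    and E :: "('n \<times> 'n) set"
    and A :: "'n \<Rightarrow> 'n \<Rightarrow> real"
  assumes "CARD('n) \<ge> 2"
    and "\<And>i. b i \<noteq> 0"
    and "\<And>i. continuously_differentiable (\<phi> i)"
    and "\<And>i. continuously_differentiable (f i)"
    and "\<And>i. (l i)-lipschitz_on UNIV (partial_deriv i (f i))"
    and "m > 0"
    and "\<And>x z. (x - z) \<bullet> (pseudo_gradient f x - pseudo_gradient f z) \<ge> m * (norm (x - z))\<^sup>2"
    and "adjacency_matrix E A"
    and "undirected_graph E A"
    and "connected_graph E"
    and "\<And>i S. bounded S \<Longrightarrow> bounded (\<phi> i ` S) \<and> bounded (deriv (\<phi> i) ` S)"
  shows "\<exists>xs. (\<forall>x. nash_equilibrium f x \<longleftrightarrow> x = xs) \<and>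
    (\<forall>x0 k0 \<theta>h0 y0 z0 \<delta>0. \<exists>x k \<theta>h y z \<delta>.
        closed_loop_solution f \<phi> b \<theta> A x k \<theta>h y z \<delta> \<and>
        x 0 = x0 \<and> k 0 = k0 \<and> \<theta>h 0 = \<theta>h0 \<and> y 0 = y0 \<and> z 0 = z0 \<and> \<delta> 0 = \<delta>0) \<and>
    (\<forall>x k \<theta>h y z \<delta>. closed_loop_solution f \<phi> b \<theta> A x k \<theta>h y z \<delta> \<longrightarrow>
        ((\<lambda>t. norm (x t - xs)) \<longlongrightarrow> 0) at_top \<and>
        (\<forall>i. bounded ((\<lambda>t. k t $ i) ` {0..}) \<and>
             bounded ((\<lambda>t. \<theta>h t $ i) ` {0..}) \<and>
             bounded ((\<lambda>t. y t $ i) ` {0..}) \<and>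
             (\<forall>j. bounded ((\<lambda>t. z t $ i $ j) ` {0..}) \<and>
                  bounded ((\<lambda>t. \<delta> t $ i $ j) ` {0..}))))"
proof -
  interpret nash_seeking f \<phi> b \<theta> l m E A
    by unfold_locales (rule assms)+
  show ?thesis
  proof (intro exI[of _ equilibrium] conjI)
    show "\<forall>x. nash_equilibrium f x \<longleftrightarrow> x = equilibrium"
      using nash_equilibrium_iff by blast
    show "\<forall>x0 k0 \<theta>h0 y0 z0 \<delta>0. \<exists>x k \<theta>h y z \<delta>.
        closed_loop_solution f \<phi> b \<theta> A x k \<theta>h y z \<delta> \<and>
        x 0 = x0 \<and> k 0 = k0 \<and> \<theta>h 0 = \<theta>h0 \<and> y 0 = y0 \<and> z 0 = z0 \<and> \<delta> 0 = \<delta>0"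
      unfolding closed_loop_solution_iff by (intro allI closed_loop_exists)
    show "\<forall>x k \<theta>h y z \<delta>. closed_loop_solution f \<phi> b \<theta> A x k \<theta>h y z \<delta> \<longrightarrow>
        ((\<lambda>t. norm (x t - equilibrium)) \<longlongrightarrow> 0) at_top \<and>
        (\<forall>i. bounded ((\<lambda>t. k t $ i) ` {0..}) \<and>
             bounded ((\<lambda>t. \<theta>h t $ i) ` {0..}) \<and>
             bounded ((\<lambda>t. y t $ i) ` {0..}) \<and>
             (\<forall>j. bounded ((\<lambda>t. z t $ i $ j) ` {0..}) \<and>
                  bounded ((\<lambda>t. \<delta> t $ i $ j) ` {0..})))"
      unfolding closed_loop_solution_iff
    proof (intro allI impI)
      fix x k \<theta>h y z \<delta> assume sol: "closed_loop_on {0..} x k \<theta>h y z \<delta>"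
      from closed_loop_bounded_and_convergent(2)[OF sol]
      obtain B where B: "\<forall>t\<ge>0. \<forall>i j. \<bar>k t $ i\<bar> \<le> B \<and> \<bar>\<theta>h t $ i\<bar> \<le> B \<and> \<bar>y t $ i\<bar> \<le> B \<and>
        \<bar>z t $ i $ j\<bar> \<le> B \<and> \<bar>\<delta> t $ i $ j\<bar> \<le> B" ..
      have bdd: "bounded (g ` {0..})" if "\<And>t. t \<ge> 0 \<Longrightarrow> \<bar>g t\<bar> \<le> B" for g :: "real \<Rightarrow> real"
        using that by (intro boundedI[of _ B]) auto
      show "((\<lambda>t. norm (x t - equilibrium)) \<longlongrightarrow> 0) at_top \<and>
        (\<forall>i. bounded ((\<lambda>t. k t $ i) ` {0..}) \<and>
             bounded ((\<lambda>t. \<theta>h t $ i) ` {0..}) \<and>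
             bounded ((\<lambda>t. y t $ i) ` {0..}) \<and>
             (\<forall>j. bounded ((\<lambda>t. z t $ i $ j) ` {0..}) \<and>
                  bounded ((\<lambda>t. \<delta> t $ i $ j) ` {0..})))"
        by (intro conjI allI bdd closed_loop_bounded_and_convergent(1)[OF sol]) (use B in blast)+
    qed
  qed
qed

end
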